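(* Let $X_1,X_2,\dots$ be i.i.d. with a monotone decreasing probability mass function $p$ on $\mathbb N$. Suppose that for some $r,s\in\mathbb N$ with $s-r\ge0$ we have $p_{r-1}>p_r>\dots>p_s>p_{s+1}$ (with the convention $p_{-1}=+\infty$, so that the first inequality is vacuous when $r=0$). Then, as $n\to\infty$, $$(Y_n^R)^{(r,s)}\to_dY^{(r,s)}\ \text{ in }\ \mathbb R^{s-r+1},\qquad(Y_n^G)^{(r,s)}\to_dY^{(r,s)}\ \text{ in }\ \mathbb R^{s-r+1}.$$
   Context: $\mathbb N=\{0,1,2,\dots\}$. $p$ is monotone decreasing if $p_x\ge p_{x+1}$ for all $x\in\mathbb N$. The empirical estimator is $\widehat p_{n,x}=n^{-1}\#\{i\le n:X_i=x\}$. For a finite vector $w=(w_0,\dots,w_k)$, $\mathrm{rear}(w)$ is the vector of entries of $w$ sorted in nonincreasing order, and $\mathrm{gren}(w)$ is the vector of the $k+1$ left slopes, at $j=0,\dots,k$, of the least concave majorant of the points $\{(j,\sum_{i=0}^jw_i):j=-1,0,\dots,k\}$ (empty sum $=0$). The rearrangement estimator is $\widehat p_n^R=\mathrm{rear}(\widehat p_n)$ and the Grenander estimator (MLE) is $\widehat p_n^G=\mathrm{gren}(\widehat p_n)$; both operators are applied to the finite vector $(\widehat p_{n,x})_{0\le x\le\max_{i\le n}X_i}$, and the results are extended by $0$ to $\mathbb N$. Fluctuation processes: $Y_{n,x}^R=\sqrt n(\widehat p_{n,x}^R-p_x)$, $Y_{n,x}^G=\sqrt n(\widehat p_{n,x}^G-p_x)$.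 $Y=(Y_x)_{x\in\mathbb N}$ is the mean-zero Gaussian process in $\ell_2$ with $\mathrm{cov}(Y_x,Y_{x'})=p_x\delta_{x,x'}-p_xp_{x'}$. For a sequence $v$, $v^{(r,s)}=(v_r,v_{r+1},\dots,v_s)$. $\to_d$ denotes convergence in distribution. *)

theory Defs
  imports "HOL-Probability.Probability" "HOL-Library.More_List"
begin

text \<open>A vector \<open>w = (w\<^sub>0, \<dots>, w\<^sub>k)\<close> is the list \<open>[w\<^sub>0, \<dots>, w\<^sub>k]\<close> of length \<open>k + 1\<close>.\<close>

definition rear :: "real list \<Rightarrow> real list" where
  "rear w = rev (sort w)"

text \<open>The points \<open>(j, w\<^sub>0 + \<dots> + w\<^sub>j)\<close> for \<open>j = -1, 0, \<dots>, k\<close>, parametrised by \<open>i = j + 1\<close>.\<close>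

definition cumsum_points :: "real list \<Rightarrow> (real \<times> real) set" where
  "cumsum_points w = {(real i - 1, sum_list (take i w)) | i. i \<le> length w}"

text \<open>
  The least concave majorant of a set of planar points, as a function on the convex hull of
  their abscissae; its values outside that interval are irrelevant.
\<close>

definition least_concave_majorant :: "(real \<times> real) set \<Rightarrow> real \<Rightarrow> real" where
  "least_concave_majorant P t =
     Inf {h t | h. concave_on (convex hull (fst ` P)) h \<and> (\<forall>(a, b) \<in> P. b \<le> h a)}"

definition left_slope :: "(real \<Rightarrow> real) \<Rightarrow> real \<Rightarrow> real" where
  "left_slope f t = (THE D. (f has_real_derivative D) (at_left t))"

definition gren :: "real list \<Rightarrow> real list" where
  "gren w = map (\<lambda>j. left_slope (least_concave_majorant (cumsum_points w)) (real j))
              [0..<length w]"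

text \<open>The sample is \<open>X 1, X 2, \<dots>\<close>; the value \<open>X 0\<close> is never used.\<close>

definition empirical :: "(nat \<Rightarrow> 'a \<Rightarrow> nat) \<Rightarrow> nat \<Rightarrow> 'a \<Rightarrow> nat \<Rightarrow> real" where
  "empirical X n \<omega> x = real (card {i \<in> {1..n}. X i \<omega> = x}) / real n"

definition empirical_vec :: "(nat \<Rightarrow> 'a \<Rightarrow> nat) \<Rightarrow> nat \<Rightarrow> 'a \<Rightarrow> real list" where
  "empirical_vec X n \<omega> = map (empirical X n \<omega>) [0..<Suc (Max ((\<lambda>i. X i \<omega>) ` {1..n}))]"

definition rear_estimator :: "(nat \<Rightarrow> 'a \<Rightarrow> nat) \<Rightarrow> nat \<Rightarrow> 'a \<Rightarrow> nat \<Rightarrow> real" where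
  "rear_estimator X n \<omega> = nth_default 0 (rear (empirical_vec X n \<omega>))"

definition gren_estimator :: "(nat \<Rightarrow> 'a \<Rightarrow> nat) \<Rightarrow> nat \<Rightarrow> 'a \<Rightarrow> nat \<Rightarrow> real" where
  "gren_estimator X n \<omega> = nth_default 0 (gren (empirical_vec X n \<omega>))"

definition Y_R :: "nat pmf \<Rightarrow> (nat \<Rightarrow> 'a \<Rightarrow> nat) \<Rightarrow> nat \<Rightarrow> 'a \<Rightarrow> nat \<Rightarrow> real" where
  "Y_R p X n \<omega> x = sqrt (real n) * (rear_estimator X n \<omega> x - pmf p x)"

definition Y_G :: "nat pmf \<Rightarrow> (nat \<Rightarrow> 'a \<Rightarrow> nat) \<Rightarrow> nat \<Rightarrow> 'a \<Rightarrow> nat \<Rightarrow> real" where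
  "Y_G p X n \<omega> x = sqrt (real n) * (gren_estimator X n \<omega> x - pmf p x)"

text \<open>Point masses count as normal distributions: the limit covariance may be singular.\<close>

definition gaussian_rv :: "'b measure \<Rightarrow> ('b \<Rightarrow> real) \<Rightarrow> bool" where
  "gaussian_rv N Z \<longleftrightarrow> Z \<in> borel_measurable N \<and>
     ((\<exists>\<mu>. AE \<omega> in N. Z \<omega> = \<mu>) \<or>
      (\<exists>\<mu> \<sigma>. 0 < \<sigma> \<and> distributed N lborel Z (\<lambda>x. ennreal (normal_density \<mu> \<sigma> x))))"

definition gaussian_process :: "'b measure \<Rightarrow> ('b \<Rightarrow> nat \<Rightarrow> real) \<Rightarrow> bool" where
  "gaussian_process N Y \<longleftrightarrow>
     (\<forall>J a. finite J \<longrightarrow> gaussian_rv N (\<lambda>\<omega>. \<Sum>x\<in>J. a x * Y \<omega> x))"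

definition covariance :: "'b measure \<Rightarrow> ('b \<Rightarrow> real) \<Rightarrow> ('b \<Rightarrow> real) \<Rightarrow> real" where
  "covariance N U V =
     (\<integral>\<omega>. (U \<omega> - (\<integral>\<omega>'. U \<omega>' \<partial>N)) * (V \<omega> - (\<integral>\<omega>'. V \<omega>' \<partial>N)) \<partial>N)"

definition limit_process :: "nat pmf \<Rightarrow> 'b measure \<Rightarrow> ('b \<Rightarrow> nat \<Rightarrow> real) \<Rightarrow> bool" where
  "limit_process p N Y \<longleftrightarrow>
     prob_space N \<and> gaussian_process N Y \<and>
     (AE \<omega> in N. summable (\<lambda>x. (Y \<omega> x)\<^sup>2)) \<and>
     (\<forall>x. (\<integral>\<omega>. Y \<omega> x \<partial>N) = 0) \<and>
     (\<forall>x x'. covariance N (\<lambda>\<omega>. Y \<omega> x) (\<lambda>\<omega>. Y \<omega> x') =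
        (if x = x' then pmf p x else 0) - pmf p x * pmf p x')"

text \<open>
  Vectors indexed by a finite set \<open>I\<close> are the functions in \<open>I \<rightarrow>\<^sub>E UNIV\<close>, so that
  \<open>(v\<^sub>r, \<dots>, v\<^sub>s)\<close> is \<open>restrict v {r..s}\<close>. The product topology on them is the
  Euclidean topology of dimension \<open>card I\<close>, with Borel sets \<open>Pi\<^sub>M I (\<lambda>_. borel)\<close>.
  Measurability is part of the notion; without it the integrals carry no information.
\<close>

definition converges_in_distribution ::
    "'i set \<Rightarrow> 'a measure \<Rightarrow> (nat \<Rightarrow> 'a \<Rightarrow> 'i \<Rightarrow> real) \<Rightarrow> 'b measure \<Rightarrow> ('b \<Rightarrow> 'i \<Rightarrow> real) \<Rightarrow> bool"
  where
  "converges_in_distribution I M V N W \<longleftrightarrow>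
     (\<forall>n. V n \<in> measurable M (Pi\<^sub>M I (\<lambda>_. borel))) \<and>
     W \<in> measurable N (Pi\<^sub>M I (\<lambda>_. borel)) \<and>
     (\<forall>f. continuous_map (product_topology (\<lambda>_. euclideanreal) I) euclideanreal f \<and>
          bounded (f ` (I \<rightarrow>\<^sub>E UNIV)) \<longrightarrow>
          (\<lambda>n. \<integral>\<omega>. f (V n \<omega>) \<partial>M) \<longlonglongrightarrow> (\<integral>\<omega>. f (W \<omega>) \<partial>N))"

end

theory Submission
  imports Defs "HOL-Library.Multiset"
begin

text \<open>
  If every entry of a vector before position \<open>x\<close> is at least the entry at \<open>x\<close>, and every later
  entry is at most that entry, then both the rearrangement and the Grenander operator leave the
  entry at \<open>x\<close> unchanged. The variances of the empirical frequencies sum to at most \<open>1 / n\<close>, so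
  with probability tending to one all frequencies are uniformly so close to \<open>p\<close> that this
  condition holds at every \<open>x\<close> in \<open>{r..s}\<close>; there both estimators coincide with the empirical
  one. It remains to prove the multivariate central limit theorem for the empirical frequencies,
  which follows from the one-dimensional theorem by the Cramer--Wold device. The latter is
  obtained from the Stone--Weierstrass theorem: up to a tail term, a bounded continuous function
  is uniformly approximated by trigonometric polynomials.
\<close>

section \<open>Entries fixed by the rearrangement and by the Grenander operator\<close>

text \<open>In ascending order the entries after position \<open>x\<close> may all be placed before
  \<open>w ! x\<close> and the \<open>x\<close> earlier ones after it. Reversing puts
  \<open>w ! x\<close> back at index \<open>x\<close>; ties do no harm.\<close>

lemma rear_nth_eq:
  assumes x: "x < length w"
    and before: "\<And>i. i < x \<Longrightarrow> w ! x \<le> w ! i"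
    and after: "\<And>i. x < i \<Longrightarrow> i < length w \<Longrightarrow> w ! i \<le> w ! x"
  shows "rear w ! x = w ! x"
proof -
  define u v where "u = take x w" and "v = drop (Suc x) w"
  have w: "w = u @ w ! x # v"
    unfolding u_def v_def using x by (rule id_take_nth_drop)
  have u: "w ! x \<le> a" if "a \<in> set u" for a
    using that x before by (auto simp: u_def in_set_conv_nth)
  have v: "a \<le> w ! x" if "a \<in> set v" for a
    using that x after by (auto simp: v_def in_set_conv_nth)
  have "sort w = sort v @ w ! x # sort u"
  proof (rule properties_for_sort)
    show "mset (sort v @ w ! x # sort u) = mset w"
      by (subst (2) w) (simp add: union_commute)
    show "sorted (sort v @ w ! x # sort u)"
      using u v by (auto simp: sorted_append intro: order_trans)
  qed
  moreover have "length u = x"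
    using x by (simp add: u_def)
  ultimately show ?thesis
    by (simp add: rear_def nth_append)
qed

lemma sum_list_take_minus:
  fixes w :: "real list"
  assumes "i \<le> j" "j \<le> length w"
  shows "sum_list (take j w) - sum_list (take i w) = (\<Sum>k=i..<j. w ! k)"
proof -
  have "sum_list (take m w) = (\<Sum>k<m. w ! k)" if "m \<le> length w" for m
    using that by (simp add: sum_list_sum_nth min_def atLeast0LessThan)
  moreover have "(\<Sum>k<j. w ! k) = (\<Sum>k<i. w ! k) + (\<Sum>k=i..<j. w ! k)"
    using assms by (simp add: sum.atLeastLessThan_concat flip: atLeast0LessThan)
  ultimately show ?thesis using assms by simp
qed

text \<open>The line through the points of abscissae \<open>x - 1\<close> and \<open>x\<close> lies above all cumulative
  sums, so the majorant coincides with it between these two points.\<close>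

lemma gren_nth_eq:
  assumes x: "x < length w"
    and before: "\<And>i. i < x \<Longrightarrow> w ! x \<le> w ! i"
    and after: "\<And>i. x < i \<Longrightarrow> i < length w \<Longrightarrow> w ! i \<le> w ! x"
  shows "gren w ! x = w ! x"
proof -
  define P where "P = cumsum_points w"
  define H where "H = convex hull (fst ` P)"
  \<comment> \<open>Index shift: \<open>F i\<close> is the ordinate at abscissa
    \<open>i - 1\<close>. The segment of slope \<open>w ! x\<close> thus runs from
    \<open>F x\<close> at \<open>x - 1\<close> to \<open>F (Suc x)\<close> at \<open>x\<close>, and
    \<open>l\<close> is the line through it.\<close>
  define F where "F i = sum_list (take i w)" for i
  define l where "l t = F x + (t - (real x - 1)) * w ! x" for t :: real
  have P_iff: "(a, b) \<in> P \<longleftrightarrow> (\<exists>i\<le>length w. a = real i - 1 \<and> b = F i)" for a b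
    by (auto simp: P_def cumsum_points_def F_def)
  have F_le: "F i \<le> l (real i - 1)" if "i \<le> length w" for i
  proof (cases "i \<le> x")
    case True
    have "(\<Sum>k=i..<x. w ! x) \<le> (\<Sum>k=i..<x. w ! k)"
      by (intro sum_mono before) auto
    also have "\<dots> = F x - F i"
      unfolding F_def using True x by (subst sum_list_take_minus) auto
    finally show ?thesis
      using True by (simp add: l_def of_nat_diff algebra_simps)
  next
    case False
    have "F i - F x = (\<Sum>k=x..<i. w ! k)"
      unfolding F_def using False that by (subst sum_list_take_minus) auto
    also have "\<dots> \<le> (\<Sum>k=x..<i. w ! x)"
    proof (rule sum_mono)
      fix k assume "k \<in> {x..<i}"
      then show "w ! k \<le> w ! x"
        using after[of k] that by (cases "k = x") auto
    qed
    finally show ?thesis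
      using False by (simp add: l_def of_nat_diff algebra_simps)
  qed
  have l_Suc: "l (real x) = F (Suc x)"
    using x by (simp add: l_def F_def take_Suc_conv_app_nth)
  have in_P: "(real x - 1, F x) \<in> P" "(real x, F (Suc x)) \<in> P"
    using x unfolding P_iff by (auto intro: exI[of _ x] exI[of _ "Suc x"])
  then have in_H: "real x - 1 \<in> H" "real x \<in> H"
    unfolding H_def by (force intro: hull_inc)+
  have concave_l: "concave_on H l"
    unfolding concave_on_iff
  proof (intro conjI ballI allI impI)
    fix t t' u v :: real assume "u + v = 1"
    then have v: "v = 1 - u" by simp
    show "u * l t + v * l t' \<le> l (u *\<^sub>R t + v *\<^sub>R t')"
      unfolding v l_def by (simp add: algebra_simps)
  qed (simp add: H_def)
  have majorant_eq: "least_concave_majorant P t = l t"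
    if t: "real x - 1 \<le> t" "t \<le> real x" for t
    unfolding least_concave_majorant_def
  proof (rule cInf_eq_minimum, safe)
    show "\<exists>h. l t = h t \<and> concave_on (convex hull fst ` P) h \<and> (\<forall>(a, b)\<in>P. b \<le> h a)"
      using concave_l F_le by (intro exI[of _ l]) (auto simp: H_def P_iff)
  next
    \<comment> \<open>A concave majorant lies above its own chord between \<open>x - 1\<close> and
      \<open>x\<close>, hence above the chord of the two points, which is \<open>l\<close>.\<close>
    fix h assume h: "concave_on (convex hull fst ` P) h" "\<forall>(a, b)\<in>P. b \<le> h a"
    define \<theta> where "\<theta> = t - (real x - 1)"
    have \<theta>: "0 \<le> \<theta>" "\<theta> \<le> 1" "t = (1 - \<theta>) * (real x - 1) + \<theta> * real x"
      using t by (simp_all add: \<theta>_def algebra_simps)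
    have "l t = (1 - \<theta>) * F x + \<theta> * F (Suc x)"
      unfolding l_Suc[symmetric] by (simp add: l_def \<theta>_def algebra_simps)
    also have "\<dots> \<le> (1 - \<theta>) * h (real x - 1) + \<theta> * h (real x)"
      using \<theta> h(2) in_P by (intro add_mono mult_left_mono) auto
    also have "\<dots> \<le> h t"
      using concave_onD[OF h(1), of \<theta> "real x - 1" "real x"] \<theta> in_H by (simp add: H_def)
    finally show "l t \<le> h t" .
  qed
  have "(l has_real_derivative w ! x) (at_left (real x))"
    unfolding l_def by (auto intro!: derivative_eq_intros)
  \<comment> \<open>A left derivative sees only points just below \<open>x\<close> and
    \<open>x\<close> itself, so agreement on \<open>[x - 1, x]\<close> suffices, whatever the
    majorant does elsewhere.\<close>
  moreover have "\<forall>\<^sub>F t in at_left (real x). l t = least_concave_majorant P t"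
    using majorant_eq by (intro eventually_at_leftI[of "real x - 1"]) auto
  ultimately have deriv:
    "(least_concave_majorant P has_real_derivative w ! x) (at_left (real x))"
    using majorant_eq[of "real x"]
    by (subst has_field_derivative_cong_eventually[symmetric]) auto
  then have "left_slope (least_concave_majorant P) (real x) = w ! x"
    unfolding left_slope_def
    by (blast intro: has_field_derivative_unique[OF _ _ trivial_limit_at_left_real])
  then show ?thesis
    using x by (simp add: gren_def P_def)
qed

lemma length_rear [simp]: "length (rear w) = length w"
  by (simp add: rear_def)

lemma length_gren [simp]: "length (gren w) = length w"
  by (simp add: gren_def)

section \<open>The Cramer--Wold device\<close>

text \<open>Trigonometric polynomials in the functions \<open>sin (c * x i)\<close> alone. On a box
  \<open>\<bar>x i\<bar> \<le> pi / (2 * c)\<close> they separate points, and each of their values is already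
  attained on that box (\<open>sin_algebra_fold\<close>). Hence a uniform approximation on the box stays
  bounded on the whole space.\<close>

inductive_set sin_algebra :: "real \<Rightarrow> 'i set \<Rightarrow> (('i \<Rightarrow> real) \<Rightarrow> real) set" for c I where
  const: "(\<lambda>_. k) \<in> sin_algebra c I"
| add: "p \<in> sin_algebra c I \<Longrightarrow> q \<in> sin_algebra c I \<Longrightarrow> (\<lambda>x. p x + q x) \<in> sin_algebra c I"
| sin_mult: "i \<in> I \<Longrightarrow> q \<in> sin_algebra c I \<Longrightarrow> (\<lambda>x. sin (c * x i) * q x) \<in> sin_algebra c I"

text \<open>The generating rule multiplies by one sine at a time, which keeps inductions short. This
  lemma and the next recover the closure under products that Stone-Weierstrass requires.\<close>

lemma sin_algebra_scale:
  "q \<in> sin_algebra c I \<Longrightarrow> (\<lambda>x. k * q x) \<in> sin_algebra c I"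
proof (induction rule: sin_algebra.induct)
  case (sin_mult i q)
  then show ?case
    using sin_algebra.sin_mult[of i I "\<lambda>x. k * q x" c] by (simp add: ac_simps)
qed (auto simp: distrib_left intro: sin_algebra.intros)

lemma sin_algebra_mult:
  assumes "p \<in> sin_algebra c I" and q: "q \<in> sin_algebra c I"
  shows "(\<lambda>x. p x * q x) \<in> sin_algebra c I"
  using assms(1)
proof (induction rule: sin_algebra.induct)
  case (sin_mult i p)
  then show ?case
    using sin_algebra.sin_mult[of i I "\<lambda>x. p x * q x" c] by (simp add: ac_simps)
qed (auto simp: distrib_right sin_algebra_scale[OF q] intro: sin_algebra.intros)

lemma sin_algebra_continuous:
  fixes q :: "('i::countable \<Rightarrow> real) \<Rightarrow> real"
  assumes "q \<in> sin_algebra c I" shows "continuous_on S q"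
  using assms
proof (induction rule: sin_algebra.induct)
  case (sin_mult i q)
  have "continuous_on S (\<lambda>x::'i \<Rightarrow> real. x i)"
    by (rule continuous_on_subset[OF continuous_on_product_coordinates]) simp
  then show ?case
    using sin_mult by (intro continuous_on_mult continuous_on_sin continuous_on_const)
qed (auto intro: continuous_on_const continuous_on_add)

lemma sin_algebra_bounded:
  assumes "q \<in> sin_algebra c I" shows "\<exists>B. \<forall>x. \<bar>q x\<bar> \<le> B"
  using assms
proof (induction rule: sin_algebra.induct)
  case (add p q)
  then obtain B B' where "\<And>x. \<bar>p x\<bar> \<le> B" "\<And>x. \<bar>q x\<bar> \<le> B'" by blast
  then show ?case
    by (intro exI[of _ "B + B'"]) (meson abs_triangle_ineq add_mono order_trans)
next
  case (sin_mult i q)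
  then obtain B where B: "\<And>x. \<bar>q x\<bar> \<le> B" by blast
  have "\<bar>sin (c * x i) * q x\<bar> \<le> 1 * B" for x
    unfolding abs_mult by (intro mult_mono B) auto
  then show ?case by auto
qed auto

lemma sin_algebra_measurable:
  assumes "q \<in> sin_algebra c I" and "\<And>i. i \<in> I \<Longrightarrow> (\<lambda>\<omega>. V \<omega> i) \<in> borel_measurable M"
  shows "(\<lambda>\<omega>. q (V \<omega>)) \<in> borel_measurable M"
  using assms(1)
proof (induction rule: sin_algebra.induct)
  case (sin_mult i q)
  note [measurable] = sin_mult(3) assms(2)[OF sin_mult(1)]
  show ?case by measurable
qed auto

text \<open>An element depends on \<open>x\<close> only through the values
  \<open>sin (c * x i)\<close> with \<open>i\<close> in \<open>I\<close>, and
  \<open>sin (arcsin t) = t\<close> on the range of the sine.\<close>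

lemma sin_algebra_fold:
  assumes "q \<in> sin_algebra c I" and c: "c \<noteq> 0"
  shows "q (\<lambda>i\<in>I. arcsin (sin (c * x i)) / c) = q x"
  using assms(1) by (induction rule: sin_algebra.induct) (simp_all add: c sin_arcsin)

text \<open>Stone-Weierstrass on a compact box. The frequency \<open>pi / (2 * L)\<close> maps
  \<open>[-L, L]\<close> onto \<open>[-pi/2, pi/2]\<close>, where the sine is injective, so the
  coordinate sines separate points.\<close>

lemma sin_algebra_dense:
  fixes f :: "('i::countable \<Rightarrow> real) \<Rightarrow> real"
  assumes f: "continuous_on (I \<rightarrow>\<^sub>E UNIV) f" and L: "L > 0" and "e > 0"
  shows "\<exists>q\<in>sin_algebra (pi / (2 * L)) I. \<forall>x\<in>I \<rightarrow>\<^sub>E {-L..L}. \<bar>f x - q x\<bar> < e"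
proof -
  interpret function_ring_on "sin_algebra (pi / (2 * L)) I" "I \<rightarrow>\<^sub>E {-L..L}"
  proof
    \<comment> \<open>Seen as a product over all indices, the box has the compact factor
      \<open>{undefined}\<close> outside \<open>I\<close>, so Tychonoff applies.\<close>
    have box: "(I \<rightarrow>\<^sub>E {-L..L}) = (\<Pi>\<^sub>E i\<in>UNIV. if i \<in> I then {-L..L} else {undefined})"
      by (auto simp: PiE_iff extensional_def split: if_splits)
    have "compactin (product_topology (\<lambda>_. euclidean) UNIV) (I \<rightarrow>\<^sub>E {-L..L})"
      unfolding box compactin_PiE by auto
    then show "compact (I \<rightarrow>\<^sub>E {-L..L})"
      by (simp add: euclidean_product_topology)
  next
    fix x y assume xy: "x \<in> I \<rightarrow>\<^sub>E {-L..L}" "y \<in> I \<rightarrow>\<^sub>E {-L..L}" "x \<noteq> y"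
    then obtain i where i: "i \<in> I" "x i \<noteq> y i"
      by (metis PiE_ext)
    have range: "-(pi / 2) \<le> pi / (2 * L) * t \<and> pi / (2 * L) * t \<le> pi / 2" if "t \<in> {-L..L}" for t
    proof -
      have "pi / (2 * L) * (-L) \<le> pi / (2 * L) * t" "pi / (2 * L) * t \<le> pi / (2 * L) * L"
        using that L by (intro mult_left_mono; simp)+
      moreover have "pi / (2 * L) * L = pi / 2"
        using L by simp
      ultimately show ?thesis by linarith
    qed
    have "sin (pi / (2 * L) * x i) \<noteq> sin (pi / (2 * L) * y i)"
      using i L range[OF PiE_mem[OF xy(1) i(1)]] range[OF PiE_mem[OF xy(2) i(1)]]
        sin_inj_pi[of "pi / (2 * L) * x i" "pi / (2 * L) * y i"] by auto
    then show "\<exists>q\<in>sin_algebra (pi / (2 * L)) I. q x \<noteq> q y"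
      using sin_mult[OF i(1) const[of 1 "pi / (2 * L)"]]
      by (intro bexI[where x = "\<lambda>x. sin (pi / (2 * L) * x i) * 1"]) auto
  qed (auto intro: sin_algebra.intros sin_algebra_mult sin_algebra_continuous)
  have "continuous_on (I \<rightarrow>\<^sub>E {-L..L}) f"
    by (rule continuous_on_subset[OF f]) auto
  from Stone_Weierstrass_basic[OF this \<open>e > 0\<close>] show ?thesis .
qed

lemma sin_algebra_cos_integrable:
  assumes "finite_measure M" and q: "q \<in> sin_algebra c I"
    and V: "\<And>i. i \<in> I \<Longrightarrow> (\<lambda>\<omega>. V \<omega> i) \<in> borel_measurable M"
  shows "integrable M (\<lambda>\<omega>. q (V \<omega>) * cos ((\<Sum>i\<in>I. a i * V \<omega> i) + b))"
proof -
  interpret finite_measure M by fact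
  obtain B where B: "\<And>x. \<bar>q x\<bar> \<le> B"
    using sin_algebra_bounded[OF q] by blast
  have "\<bar>q x * cos t\<bar> \<le> B * 1" for x t
    unfolding abs_mult by (intro mult_mono B order_trans[OF abs_ge_zero B]) auto
  then have "AE \<omega> in M. norm (q (V \<omega>) * cos ((\<Sum>i\<in>I. a i * V \<omega> i) + b)) \<le> B"
    by simp
  moreover have "(\<lambda>\<omega>. q (V \<omega>) * cos ((\<Sum>i\<in>I. a i * V \<omega> i) + b)) \<in> borel_measurable M"
    using V by (intro borel_measurable_times sin_algebra_measurable[OF q] borel_measurable_cos
        borel_measurable_add borel_measurable_sum borel_measurable_const) auto
  ultimately show ?thesis
    by (rule integrable_const_bound)
qed

text \<open>The cosine factor makes the induction work: multiplying it by a sine gives a sum of two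
  cosines.\<close>

lemma sin_algebra_tendsto:
  fixes V :: "nat \<Rightarrow> 'a \<Rightarrow> 'i \<Rightarrow> real" and W :: "'b \<Rightarrow> 'i \<Rightarrow> real"
  assumes "prob_space M" and "prob_space N" and I: "finite I"
    and V: "\<And>n i. i \<in> I \<Longrightarrow> (\<lambda>\<omega>. V n \<omega> i) \<in> borel_measurable M"
    and W: "\<And>i. i \<in> I \<Longrightarrow> (\<lambda>\<omega>. W \<omega> i) \<in> borel_measurable N"
    and conv: "\<And>a b. (\<lambda>n. \<integral>\<omega>. cos ((\<Sum>i\<in>I. a i * V n \<omega> i) + b) \<partial>M)
                 \<longlonglongrightarrow> (\<integral>\<omega>. cos ((\<Sum>i\<in>I. a i * W \<omega> i) + b) \<partial>N)"
    and "q \<in> sin_algebra c I"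
  shows "(\<lambda>n. \<integral>\<omega>. q (V n \<omega>) * cos ((\<Sum>i\<in>I. a i * V n \<omega> i) + b) \<partial>M)
           \<longlonglongrightarrow> (\<integral>\<omega>. q (W \<omega>) * cos ((\<Sum>i\<in>I. a i * W \<omega> i) + b) \<partial>N)"
  using assms(7)
proof (induction arbitrary: a b rule: sin_algebra.induct)
  case (const k)
  show ?case using conv by (auto intro: tendsto_intros)
next
  interpret M: prob_space M by fact
  interpret N: prob_space N by fact
  note int = sin_algebra_cos_integrable[where c = c, OF M.finite_measure _ V]
    sin_algebra_cos_integrable[where c = c, OF N.finite_measure _ W]
  case (add p q)
  show ?case
    using tendsto_add[OF add(3,4)]
    by (simp add: distrib_right int(1)[OF add(1)] int(1)[OF add(2)] int(2)[OF add(1)] int(2)[OF add(2)])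
  case (sin_mult j q)
  \<comment> \<open>With \<open>v\<close> the argument of the cosine and \<open>A = c * x j\<close>,
    \<open>sin A * cos v\<close> is half of \<open>sin (v + A) + sin (- v + A)\<close>; the signs of
    \<open>v\<close> are \<open>u = 1\<close> and \<open>u = -1\<close>. Adding \<open>c\<close> to
    the coefficient of \<open>j\<close> absorbs \<open>A\<close>, and the shift by
    \<open>pi / 2\<close> turns sines into cosines, so the induction hypothesis applies with new
    \<open>a\<close> and \<open>b\<close>.\<close>
  define a' where "a' u = (\<lambda>i. u * a i + (if i = j then c else 0))" for u :: real
  define h where "h u x = q x * cos ((\<Sum>i\<in>I. a' u i * x i) + (u * b - pi / 2))" for u x
  have sum_a': "(\<Sum>i\<in>I. a' u i * x i) = u * (\<Sum>i\<in>I. a i * x i) + c * x j" for u x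
    using \<open>j \<in> I\<close> I
    by (simp add: a'_def distrib_right sum.distrib sum_distrib_left if_distrib[of "\<lambda>t. t * _"]
        mult.assoc sum.delta cong: if_cong)
  have cos_shift: "cos (t - pi / 2) = sin t" for t :: real
    by (simp add: cos_diff)
  have product: "sin (c * x j) * q x * cos ((\<Sum>i\<in>I. a i * x i) + b) = (h 1 x + h (-1) x) / 2" for x
  proof -
    define v where "v = (\<Sum>i\<in>I. a i * x i) + b"
    have "(\<Sum>i\<in>I. a' u i * x i) + (u * b - pi / 2) = (u * v + c * x j) - pi / 2" for u
      unfolding sum_a' v_def by (simp add: algebra_simps)
    then have h: "h u x = q x * sin (u * v + c * x j)" for u
      by (simp only: h_def cos_shift)
    have "sin (v + c * x j) + sin (- v + c * x j) = 2 * (sin (c * x j) * cos v)"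
      by (simp add: sin_add sin_diff)
    then show ?thesis
      unfolding h v_def[symmetric] by (simp flip: distrib_left)
  qed
  have "integrable M (\<lambda>\<omega>. h u (V n \<omega>))" for u n
    unfolding h_def by (rule int(1)[OF sin_mult(2)])
  moreover have "integrable N (\<lambda>\<omega>. h u (W \<omega>))" for u
    unfolding h_def by (rule int(2)[OF sin_mult(2)])
  moreover have "(\<lambda>n. \<integral>\<omega>. h u (V n \<omega>) \<partial>M) \<longlonglongrightarrow> (\<integral>\<omega>. h u (W \<omega>) \<partial>N)" for u
    unfolding h_def by (rule sin_mult(3))
  ultimately show ?case
    unfolding product by (auto intro!: tendsto_add tendsto_divide)
qed

text \<open>A continuous stand-in for the indicator of \<open>\<bar>t\<bar> > L\<close>: unlike the
  indicator, it is a valid test function for convergence in distribution. It vanishes for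
  \<open>\<bar>t\<bar> \<le> L - 1\<close>.\<close>

definition tail_bump :: "real \<Rightarrow> real \<Rightarrow> real" where
  "tail_bump L t = min 1 (max 0 (\<bar>t\<bar> - L + 1))"

lemma tail_bump_bounds [simp]: "0 \<le> tail_bump L t" "tail_bump L t \<le> 1" "\<bar>tail_bump L t\<bar> \<le> 1"
  by (auto simp: tail_bump_def)

lemma continuous_tail_bump: "continuous_on S (tail_bump L)"
  unfolding tail_bump_def by (intro continuous_intros)

lemma tail_bump_measurable [measurable]: "tail_bump L \<in> borel_measurable borel"
  by (rule borel_measurable_continuous_onI[OF continuous_tail_bump])

lemma tail_bump_eq_1: "L < \<bar>t\<bar> \<Longrightarrow> tail_bump L t = 1"
  by (simp add: tail_bump_def)

text \<open>Tightness of a single random variable, by dominated convergence: at a fixed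
  \<open>t\<close> the bump is zero as soon as \<open>k \<ge> \<bar>t\<bar> + 1\<close>.\<close>

lemma (in prob_space) expectation_tail_bump_tendsto:
  assumes [measurable]: "U \<in> borel_measurable M"
  shows "(\<lambda>k. expectation (\<lambda>\<omega>. tail_bump (real k) (U \<omega>))) \<longlonglongrightarrow> 0"
proof -
  have lim: "(\<lambda>k. tail_bump (real k) t) \<longlonglongrightarrow> 0" for t
  proof (rule tendsto_eventually, rule eventually_sequentiallyI)
    fix k assume "nat \<lceil>\<bar>t\<bar> + 1\<rceil> \<le> k"
    then have "\<bar>t\<bar> + 1 \<le> real k" by linarith
    then show "tail_bump (real k) t = 0" by (simp add: tail_bump_def)
  qed
  have "(\<lambda>k. expectation (\<lambda>\<omega>. tail_bump (real k) (U \<omega>))) \<longlonglongrightarrow> expectation (\<lambda>_. 0)"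
    by (rule integral_dominated_convergence[where w = "\<lambda>_. 1"]) (auto simp: lim)
  then show ?thesis by simp
qed

text \<open>Inside the box this is density. Outside, some bump equals 1, so a crude bound is enough:
  folding \<open>x\<close> to a point \<open>y\<close> of the box gives
  \<open>\<bar>q x\<bar> = \<bar>q y\<bar> \<le> K + e\<close>, and with \<open>e \<le> 1\<close>
  the error is at most \<open>2 * K + 1\<close>.\<close>

lemma sin_algebra_approx:
  fixes f :: "('i::countable \<Rightarrow> real) \<Rightarrow> real"
  assumes f: "continuous_on (I \<rightarrow>\<^sub>E UNIV) f" and K: "\<And>x. x \<in> I \<rightarrow>\<^sub>E UNIV \<Longrightarrow> \<bar>f x\<bar> \<le> K"
    and I: "finite I" and L: "L > 0" and e: "0 < e" "e \<le> 1"
  shows "\<exists>q\<in>sin_algebra (pi / (2 * L)) I. \<forall>x\<in>I \<rightarrow>\<^sub>E UNIV.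
           \<bar>f x - q x\<bar> \<le> e + (2 * K + 1) * (\<Sum>i\<in>I. tail_bump L (x i))"
proof -
  define c where "c = pi / (2 * L)"
  have c: "c > 0" using L by (simp add: c_def)
  obtain q where q: "q \<in> sin_algebra c I"
    and close: "\<And>x. x \<in> I \<rightarrow>\<^sub>E {-L..L} \<Longrightarrow> \<bar>f x - q x\<bar> < e"
    using sin_algebra_dense[OF f L e(1)] unfolding c_def by blast
  have "\<bar>f x - q x\<bar> \<le> e + (2 * K + 1) * (\<Sum>i\<in>I. tail_bump L (x i))"
    if x: "x \<in> I \<rightarrow>\<^sub>E UNIV" for x
  proof -
    have K0: "0 \<le> K" using K[OF x] by linarith
    show ?thesis
    proof (cases "x \<in> I \<rightarrow>\<^sub>E {-L..L}")
      case True
      have "0 \<le> (2 * K + 1) * (\<Sum>i\<in>I. tail_bump L (x i))"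
        using K0 by (intro mult_nonneg_nonneg sum_nonneg) auto
      then show ?thesis using close[OF True] by linarith
    next
      case False
      then obtain i where i: "i \<in> I" "L < \<bar>x i\<bar>"
        using x by (force simp: PiE_iff)
      have sum_ge: "1 \<le> (\<Sum>i\<in>I. tail_bump L (x i))"
        using member_le_sum[OF i(1), of "\<lambda>i. tail_bump L (x i)"] i(2) I
        by (simp add: tail_bump_eq_1)
      define y where "y = (\<lambda>i\<in>I. arcsin (sin (c * x i)) / c)"
      have bound: "-L \<le> arcsin (sin t) / c \<and> arcsin (sin t) / c \<le> L" for t
      proof -
        have "c * (-L) \<le> arcsin (sin t)" "arcsin (sin t) \<le> c * L"
          using arcsin_bounded[of "sin t"] L by (simp_all add: c_def)
        then show ?thesis
          using c by (simp add: field_simps)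
      qed
      have y: "y \<in> I \<rightarrow>\<^sub>E {-L..L}"
        using bound by (auto simp: y_def)
      have "\<bar>q y\<bar> \<le> K + e"
        using close[OF y] K[of y] y by fastforce
      then have "\<bar>q x\<bar> \<le> K + e"
        using sin_algebra_fold[OF q, of x] c by (simp add: y_def)
      then have "\<bar>f x - q x\<bar> \<le> (2 * K + 1) * 1"
        using K[OF x] e abs_triangle_ineq4[of "f x" "q x"] by simp
      also have "\<dots> \<le> (2 * K + 1) * (\<Sum>i\<in>I. tail_bump L (x i))"
        using sum_ge K0 by (intro mult_left_mono) auto
      finally show ?thesis using e by linarith
    qed
  qed
  then show ?thesis using q unfolding c_def by blast
qed

text \<open>The hypothesis concerns only extensional functions on \<open>I\<close>. Composing with
  \<open>restrict\<close> gives a continuous function on the whole function type, with its type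
  class topology and Borel sets.\<close>

lemma continuous_on_compose_restrict:
  fixes f :: "('i \<Rightarrow> real) \<Rightarrow> real"
  assumes "continuous_map (product_topology (\<lambda>_. euclideanreal) I) euclideanreal f"
  shows "continuous_on UNIV (\<lambda>x. f (restrict x I))"
proof -
  have "continuous_map (product_topology (\<lambda>_. euclideanreal) UNIV)
      (product_topology (\<lambda>_. euclideanreal) I) (\<lambda>x. restrict x I)"
    unfolding continuous_map_componentwise
    by (auto intro: continuous_map_product_projection[OF UNIV_I])
  from continuous_map_compose[OF this assms] show ?thesis
    by (simp add: comp_def euclidean_product_topology)
qed

text \<open>\<open>V\<close> takes extensional values, so its coordinates outside \<open>I\<close>
  are the constant \<open>undefined\<close>. As there are countably many coordinates,
  \<open>V\<close> is Borel in the full function space, and \<open>f\<close> agrees with its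
  composition with \<open>restrict\<close> on the values of \<open>V\<close>.\<close>

lemma continuous_map_measurable_PiM:
  fixes f :: "('i::countable \<Rightarrow> real) \<Rightarrow> real"
  assumes f: "continuous_map (product_topology (\<lambda>_. euclideanreal) I) euclideanreal f"
    and V: "V \<in> measurable M (Pi\<^sub>M I (\<lambda>_. borel))"
  shows "(\<lambda>\<omega>. f (V \<omega>)) \<in> borel_measurable M"
proof -
  have V_space: "V \<omega> \<in> I \<rightarrow>\<^sub>E UNIV" if "\<omega> \<in> space M" for \<omega>
    using measurable_space[OF V that] by (simp add: space_PiM)
  have "V \<in> borel_measurable M"
  proof (rule measurable_coordinatewise_then_product)
    fix i
    show "(\<lambda>\<omega>. V \<omega> i) \<in> borel_measurable M"
    proof (cases "i \<in> I")
      case True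
      show ?thesis
        by (rule measurable_compose[OF V measurable_component_singleton[OF True]])
    next
      case False
      then have "V \<omega> i = undefined" if "\<omega> \<in> space M" for \<omega>
        using V_space[OF that] by (auto simp: PiE_iff extensional_def)
      then show ?thesis
        using measurable_cong[of M "\<lambda>\<omega>. V \<omega> i" "\<lambda>_. undefined" borel] by simp
    qed
  qed
  then have "(\<lambda>\<omega>. f (restrict (V \<omega>) I)) \<in> borel_measurable M"
    using borel_measurable_continuous_onI[OF continuous_on_compose_restrict[OF f]]
    by (rule measurable_compose)
  moreover have "f (restrict (V \<omega>) I) = f (V \<omega>)" if "\<omega> \<in> space M" for \<omega>
    using V_space[OF that] by (simp add: PiE_restrict)
  ultimately show ?thesis
    using measurable_cong[of M "\<lambda>\<omega>. f (restrict (V \<omega>) I)" "\<lambda>\<omega>. f (V \<omega>)" borel] by simp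
qed

lemma (in prob_space) expectation_sin_algebra_diff_le:
  assumes V: "V \<in> measurable M (Pi\<^sub>M I (\<lambda>_. borel))"
    and f: "integrable M (\<lambda>\<omega>. f (V \<omega>))" and q: "q \<in> sin_algebra c I"
    and approx: "\<And>x. x \<in> I \<rightarrow>\<^sub>E UNIV \<Longrightarrow> \<bar>f x - q x\<bar> \<le> d + C * (\<Sum>i\<in>I. tail_bump L (x i))"
  shows "\<bar>expectation (\<lambda>\<omega>. f (V \<omega>)) - expectation (\<lambda>\<omega>. q (V \<omega>))\<bar>
    \<le> d + C * (\<Sum>i\<in>I. expectation (\<lambda>\<omega>. tail_bump L (V \<omega> i)))"
proof -
  have V_coord: "(\<lambda>\<omega>. V \<omega> i) \<in> borel_measurable M" if "i \<in> I" for i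
    by (rule measurable_compose[OF V measurable_component_singleton[OF that]])
  have V_space: "V \<omega> \<in> I \<rightarrow>\<^sub>E UNIV" if "\<omega> \<in> space M" for \<omega>
    using measurable_space[OF V that] by (simp add: space_PiM)
  have q': "integrable M (\<lambda>\<omega>. q (V \<omega>))"
    \<comment> \<open>Zero coefficients and zero shift make the cosine factor equal to 1.\<close>
    using sin_algebra_cos_integrable[where V = V and a = "\<lambda>_. 0" and b = 0, OF finite_measure q V_coord] by simp
  have bump: "integrable M (\<lambda>\<omega>. tail_bump L (V \<omega> i))" if "i \<in> I" for i
    using V_coord[OF that] by (intro integrable_const_bound[of _ 1]) auto
  have "\<bar>expectation (\<lambda>\<omega>. f (V \<omega>)) - expectation (\<lambda>\<omega>. q (V \<omega>))\<bar>
      = \<bar>expectation (\<lambda>\<omega>. f (V \<omega>) - q (V \<omega>))\<bar>"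
    by (simp add: f q')
  also have "\<dots> \<le> expectation (\<lambda>\<omega>. \<bar>f (V \<omega>) - q (V \<omega>)\<bar>)"
    by (rule integral_abs_bound)
  also have "\<dots> \<le> expectation (\<lambda>\<omega>. d + C * (\<Sum>i\<in>I. tail_bump L (V \<omega> i)))"
    by (rule integral_mono) (auto simp: f q' bump approx V_space)
  also have "\<dots> = d + C * (\<Sum>i\<in>I. expectation (\<lambda>\<omega>. tail_bump L (V \<omega> i)))"
    by (simp add: bump prob_space)
  finally show ?thesis .
qed

text \<open>Replace \<open>f\<close> by a trigonometric \<open>q\<close> at the cost of a small
  constant and a tail term, the latter controlled by coordinatewise convergence. Expectations of
  \<open>q\<close> converge because they reduce to cosines of linear combinations.\<close>

lemma converges_in_distribution_Cramer_Wold: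
  fixes V :: "nat \<Rightarrow> 'a \<Rightarrow> 'i::countable \<Rightarrow> real" and W :: "'b \<Rightarrow> 'i \<Rightarrow> real"
  assumes "prob_space M" and "prob_space N" and I: "finite I"
    and V: "\<And>n. V n \<in> measurable M (Pi\<^sub>M I (\<lambda>_. borel))"
    and W: "W \<in> measurable N (Pi\<^sub>M I (\<lambda>_. borel))"
    and conv: "\<And>a g. continuous_on UNIV g \<Longrightarrow> bounded (range g) \<Longrightarrow>
      (\<lambda>n. \<integral>\<omega>. g (\<Sum>i\<in>I. a i * V n \<omega> i :: real) \<partial>M)
        \<longlonglongrightarrow> (\<integral>\<omega>. g (\<Sum>i\<in>I. a i * W \<omega> i) \<partial>N :: real)"
  shows "converges_in_distribution I M V N W"
  unfolding converges_in_distribution_def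
proof (intro conjI allI impI V W; elim conjE)
  fix f :: "('i \<Rightarrow> real) \<Rightarrow> real"
  assume f_cont: "continuous_map (product_topology (\<lambda>_. euclideanreal) I) euclideanreal f"
    and "bounded (f ` (I \<rightarrow>\<^sub>E UNIV))"
  then obtain K where K: "\<And>x. x \<in> I \<rightarrow>\<^sub>E UNIV \<Longrightarrow> \<bar>f x\<bar> \<le> K"
    by (force simp: bounded_iff)
  interpret M: prob_space M by fact
  interpret N: prob_space N by fact
  have V_coord: "(\<lambda>\<omega>. V n \<omega> i) \<in> borel_measurable M" if "i \<in> I" for n i
    by (rule measurable_compose[OF V measurable_component_singleton[OF that]])
  have W_coord: "(\<lambda>\<omega>. W \<omega> i) \<in> borel_measurable N" if "i \<in> I" for i
    by (rule measurable_compose[OF W measurable_component_singleton[OF that]])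
  have V_space: "V n \<omega> \<in> I \<rightarrow>\<^sub>E UNIV" if "\<omega> \<in> space M" for n \<omega>
    using measurable_space[OF V that] by (simp add: space_PiM)
  have W_space: "W \<omega> \<in> I \<rightarrow>\<^sub>E UNIV" if "\<omega> \<in> space N" for \<omega>
    using measurable_space[OF W that] by (simp add: space_PiM)
  have f_on: "continuous_on (I \<rightarrow>\<^sub>E UNIV) f"
  proof (rule continuous_on_eq)
    show "continuous_on (I \<rightarrow>\<^sub>E UNIV) (\<lambda>x. f (restrict x I))"
      by (rule continuous_on_subset[OF continuous_on_compose_restrict[OF f_cont]]) simp
  qed (simp add: PiE_restrict)
  have f_V: "integrable M (\<lambda>\<omega>. f (V n \<omega>))" for n
    using continuous_map_measurable_PiM[OF f_cont V]
    by (rule M.integrable_const_bound[of _ K, rotated]) (auto simp: K V_space)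
  have f_W: "integrable N (\<lambda>\<omega>. f (W \<omega>))"
    using continuous_map_measurable_PiM[OF f_cont W]
    by (rule N.integrable_const_bound[of _ K, rotated]) (auto simp: K W_space)
  \<comment> \<open>A coordinate is the linear combination whose coefficients are 1 at
    \<open>i\<close> and 0 elsewhere.\<close>
  have conv_coord: "(\<lambda>n. \<integral>\<omega>. g (V n \<omega> i) \<partial>M) \<longlonglongrightarrow> (\<integral>\<omega>. g (W \<omega> i) \<partial>N)"
    if "i \<in> I" "continuous_on UNIV g" "bounded (range g)" for i and g :: "real \<Rightarrow> real"
    using conv[OF that(2,3), of "\<lambda>j. of_bool (j = i)"] that(1) I
    by (simp add: of_bool_def if_distrib[of "\<lambda>t. t * _"] cong: if_cong)
  have conv_q: "(\<lambda>n. \<integral>\<omega>. q (V n \<omega>) \<partial>M) \<longlonglongrightarrow> (\<integral>\<omega>. q (W \<omega>) \<partial>N)" if "q \<in> sin_algebra c I" for q c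
  proof -
    have "(\<lambda>n. \<integral>\<omega>. cos ((\<Sum>i\<in>I. a i * V n \<omega> i) + b) \<partial>M)
        \<longlonglongrightarrow> (\<integral>\<omega>. cos ((\<Sum>i\<in>I. a i * W \<omega> i) + b) \<partial>N)" for a b
      by (rule conv[of "\<lambda>t. cos (t + b)" a])
        (auto intro!: continuous_intros boundedI[where B = 1])
    from sin_algebra_tendsto[OF assms(1,2) I V_coord W_coord this that, of "\<lambda>_. 0" 0]
    show ?thesis by simp
  qed
  define C where "C = 2 * K + 1"
  obtain \<omega> where "\<omega> \<in> space N" using N.not_empty by blast
  from K[OF W_space[OF this]] have C: "0 < C"
    unfolding C_def by linarith
  show "(\<lambda>n. \<integral>\<omega>. f (V n \<omega>) \<partial>M) \<longlonglongrightarrow> (\<integral>\<omega>. f (W \<omega>) \<partial>N)"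
  proof (rule LIMSEQ_I)
    fix e :: real assume e: "0 < e"
    have "(\<lambda>k. C * (\<Sum>i\<in>I. \<integral>\<omega>. tail_bump (real k) (W \<omega> i) \<partial>N)) \<longlonglongrightarrow> C * (\<Sum>i\<in>I. 0)"
      by (intro tendsto_intros N.expectation_tail_bump_tendsto W_coord)
    then have "\<forall>\<^sub>F k in sequentially. C * (\<Sum>i\<in>I. \<integral>\<omega>. tail_bump (real k) (W \<omega> i) \<partial>N) < e / 8"
      by (rule order_tendstoD) (use e in simp)
    with eventually_gt_at_top[of "0::nat"]
    have "\<forall>\<^sub>F k in sequentially. 0 < k \<and> C * (\<Sum>i\<in>I. \<integral>\<omega>. tail_bump (real k) (W \<omega> i) \<partial>N) < e / 8"
      by (rule eventually_conj)
    then obtain k :: nat where k: "0 < k"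
        "C * (\<Sum>i\<in>I. \<integral>\<omega>. tail_bump (real k) (W \<omega> i) \<partial>N) < e / 8"
      by (auto dest: eventually_happens)
    \<comment> \<open>\<open>L\<close> is chosen from the tails of the limit alone. The minimum with
      1 meets the accuracy condition of \<open>sin_algebra_approx\<close>.\<close>
    define L d where "L = real k" and "d = min 1 (e / 8)"
    have Ld: "0 < L" "0 < d" "d \<le> 1" "d \<le> e / 8"
      using k e by (simp_all add: L_def d_def)
    obtain q where q: "q \<in> sin_algebra (pi / (2 * L)) I"
      and approx: "\<And>x. x \<in> I \<rightarrow>\<^sub>E UNIV \<Longrightarrow> \<bar>f x - q x\<bar> \<le> d + C * (\<Sum>i\<in>I. tail_bump L (x i))"
      using sin_algebra_approx[OF f_on K I Ld(1-3)] unfolding C_def by blast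
    note diff_V = M.expectation_sin_algebra_diff_le[OF V f_V q approx]
    note diff_W = N.expectation_sin_algebra_diff_le[OF W f_W q approx]
    \<comment> \<open>The bumps are bounded and continuous, so the tail bound for \<open>W\<close>
      passes to \<open>V n\<close> for all large \<open>n\<close>.\<close>
    have "(\<lambda>n. C * (\<Sum>i\<in>I. \<integral>\<omega>. tail_bump L (V n \<omega> i) \<partial>M))
        \<longlonglongrightarrow> C * (\<Sum>i\<in>I. \<integral>\<omega>. tail_bump L (W \<omega> i) \<partial>N)"
      by (intro tendsto_intros conv_coord continuous_tail_bump boundedI[where B = 1]) auto
    then have "\<forall>\<^sub>F n in sequentially. C * (\<Sum>i\<in>I. \<integral>\<omega>. tail_bump L (V n \<omega> i) \<partial>M) < e / 8"
      by (rule order_tendstoD) (use k in \<open>simp add: L_def\<close>)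
    moreover have "\<forall>\<^sub>F n in sequentially. \<bar>(\<integral>\<omega>. q (V n \<omega>) \<partial>M) - (\<integral>\<omega>. q (W \<omega>) \<partial>N)\<bar> < e / 8"
      using tendstoD[OF conv_q[OF q], of "e / 8"] e by (simp add: dist_real_def)
    \<comment> \<open>Error budget: two approximation errors \<open>d\<close>, two tails and the
      difference for \<open>q\<close>, each at most \<open>e / 8\<close>.\<close>
    ultimately have "\<forall>\<^sub>F n in sequentially. \<bar>(\<integral>\<omega>. f (V n \<omega>) \<partial>M) - (\<integral>\<omega>. f (W \<omega>) \<partial>N)\<bar> < e"
    proof eventually_elim
      case (elim n)
      then show ?case
        using diff_V[of n] diff_W k(2)[folded L_def] Ld(4) e by linarith
    qed
    then show "\<exists>n0. \<forall>n\<ge>n0. norm ((\<integral>\<omega>. f (V n \<omega>) \<partial>M) - (\<integral>\<omega>. f (W \<omega>) \<partial>N)) < e"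
      by (simp add: eventually_sequentially)
  qed
qed

section \<open>Empirical frequencies\<close>

text \<open>Changing a variable only on \<open>B n\<close> moves the expectation of a test function
  bounded by \<open>K\<close> by at most \<open>2 * K * prob (B n)\<close>, which tends to
  0.\<close>

lemma (in prob_space) converges_in_distribution_modify:
  fixes V :: "nat \<Rightarrow> 'a \<Rightarrow> 'i::countable \<Rightarrow> real"
  assumes V: "converges_in_distribution I M V N W"
    and V': "\<And>n. V' n \<in> measurable M (Pi\<^sub>M I (\<lambda>_. borel))"
    and B: "\<And>n. B n \<in> events" "(\<lambda>n. prob (B n)) \<longlonglongrightarrow> 0"
    and eq: "\<And>n \<omega>. \<omega> \<in> space M \<Longrightarrow> \<omega> \<notin> B n \<Longrightarrow> V' n \<omega> = V n \<omega>"
  shows "converges_in_distribution I M V' N W"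
  unfolding converges_in_distribution_def
proof (intro conjI allI impI V'; (elim conjE)?)
  have V_meas: "V n \<in> measurable M (Pi\<^sub>M I (\<lambda>_. borel))" for n
    using V by (simp add: converges_in_distribution_def)
  show "W \<in> measurable N (Pi\<^sub>M I (\<lambda>_. borel))"
    using V by (simp add: converges_in_distribution_def)
  fix f :: "('i \<Rightarrow> real) \<Rightarrow> real"
  assume f: "continuous_map (product_topology (\<lambda>_. euclideanreal) I) euclideanreal f"
    and bdd: "bounded (f ` (I \<rightarrow>\<^sub>E UNIV))"
  then obtain K where K: "\<And>x. x \<in> I \<rightarrow>\<^sub>E UNIV \<Longrightarrow> \<bar>f x\<bar> \<le> K"
    by (force simp: bounded_iff)
  have bound: "\<bar>f (U \<omega>)\<bar> \<le> K" if "U \<in> measurable M (Pi\<^sub>M I (\<lambda>_. borel))" "\<omega> \<in> space M" for U \<omega>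
    using measurable_space[OF that] by (intro K) (simp add: space_PiM)
  have integrable: "integrable M (\<lambda>\<omega>. f (U \<omega>))" if "U \<in> measurable M (Pi\<^sub>M I (\<lambda>_. borel))" for U
    by (rule integrable_const_bound[of _ K]) (auto simp: bound[OF that] intro: continuous_map_measurable_PiM[OF f that])
  have diff: "\<bar>expectation (\<lambda>\<omega>. f (V' n \<omega>)) - expectation (\<lambda>\<omega>. f (V n \<omega>))\<bar> \<le> 2 * K * prob (B n)" for n
  proof -
    have "\<bar>expectation (\<lambda>\<omega>. f (V' n \<omega>)) - expectation (\<lambda>\<omega>. f (V n \<omega>))\<bar>
        = \<bar>expectation (\<lambda>\<omega>. f (V' n \<omega>) - f (V n \<omega>))\<bar>"
      by (simp add: integrable V' V_meas)
    also have "\<dots> \<le> expectation (\<lambda>\<omega>. \<bar>f (V' n \<omega>) - f (V n \<omega>)\<bar>)"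
      by (rule integral_abs_bound)
    also have "\<dots> \<le> expectation (\<lambda>\<omega>. 2 * K * indicator (B n) \<omega>)"
    proof (rule integral_mono)
      fix \<omega> assume \<omega>: "\<omega> \<in> space M"
      show "\<bar>f (V' n \<omega>) - f (V n \<omega>)\<bar> \<le> 2 * K * indicator (B n) \<omega>"
        using bound[OF V'[of n] \<omega>] bound[OF V_meas[of n] \<omega>] eq[OF \<omega>, of n]
        by (auto simp: indicator_def)
    qed (use B integrable V' V_meas in \<open>auto simp: less_top[symmetric]\<close>)
    also have "\<dots> = 2 * K * prob (B n)"
      using B by simp
    finally show ?thesis .
  qed
  have "(\<lambda>n. expectation (\<lambda>\<omega>. f (V' n \<omega>)) - expectation (\<lambda>\<omega>. f (V n \<omega>))) \<longlonglongrightarrow> 0"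
  proof (rule Lim_null_comparison)
    show "(\<lambda>n. 2 * K * prob (B n)) \<longlonglongrightarrow> 0"
      by (intro tendsto_mult_right_zero B)
  qed (use diff in auto)
  moreover have "(\<lambda>n. expectation (\<lambda>\<omega>. f (V n \<omega>))) \<longlonglongrightarrow> (\<integral>\<omega>. f (W \<omega>) \<partial>N)"
    using V f bdd by (simp add: converges_in_distribution_def)
  ultimately show "(\<lambda>n. expectation (\<lambda>\<omega>. f (V' n \<omega>))) \<longlonglongrightarrow> (\<integral>\<omega>. f (W \<omega>) \<partial>N)"
    using tendsto_add by fastforce
qed

text \<open>Induction on \<open>n\<close>: by independence the cross term integrates to a product of
  means, which is 0.\<close>

lemma (in prob_space) indep_vars_sum_square:
  fixes Z :: "nat \<Rightarrow> 'a \<Rightarrow> real"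
  assumes indep: "indep_vars (\<lambda>_. borel) Z UNIV"
    and mean: "\<And>i. expectation (Z i) = 0"
    and square: "\<And>i. integrable M (\<lambda>\<omega>. (Z i \<omega>)\<^sup>2)" "\<And>i. expectation (\<lambda>\<omega>. (Z i \<omega>)\<^sup>2) = v"
  shows "integrable M (\<lambda>\<omega>. (\<Sum>i<n. Z i \<omega>)\<^sup>2) \<and> expectation (\<lambda>\<omega>. (\<Sum>i<n. Z i \<omega>)\<^sup>2) = real n * v"
proof (induction n)
  case (Suc n)
  have Z: "integrable M (Z i)" for i
    using indep by (intro square_integrable_imp_integrable[OF _ square(1)]) (simp add: indep_vars_def2)
  have "indep_var borel (Z n) borel (\<lambda>\<omega>. \<Sum>i<n. Z i \<omega>)"
    by (rule indep_vars_sum) (auto intro: indep_vars_subset[OF indep])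
  note cross = indep_var_integrable[OF this] indep_var_lebesgue_integral[OF this]
  have expand: "(\<Sum>i<Suc n. Z i \<omega>)\<^sup>2
      = (\<Sum>i<n. Z i \<omega>)\<^sup>2 + 2 * (Z n \<omega> * (\<Sum>i<n. Z i \<omega>)) + (Z n \<omega>)\<^sup>2" for \<omega>
    by (simp add: power2_sum algebra_simps)
  show ?case
    unfolding expand using Suc cross Z mean square by (simp add: algebra_simps)
qed simp

section \<open>The sample and measurability of its functions\<close>

locale iid_sample = prob_space M for M :: "'a measure" +
  fixes X :: "nat \<Rightarrow> 'a \<Rightarrow> nat" and p :: "nat pmf"
  assumes indep: "indep_vars (\<lambda>_. count_space UNIV) X {1..}"
    and distr: "\<And>i. i \<ge> 1 \<Longrightarrow> distr M (count_space UNIV) (X i) = measure_pmf p"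
begin

lemma X_measurable: "i \<ge> 1 \<Longrightarrow> X i \<in> measurable M (count_space UNIV)"
  using indep by (simp add: indep_vars_def2)

text \<open>The sample is a random element of the countable type \<open>nat list\<close>, on which
  every function is measurable. This covers sorting and the Grenander operator without any study of
  their regularity.\<close>

lemma measurable_if_sample_determined:
  fixes h :: "'a \<Rightarrow> real"
  assumes h: "\<And>\<omega> \<omega>'. (\<And>i. i \<in> {1..n} \<Longrightarrow> X i \<omega> = X i \<omega>') \<Longrightarrow> h \<omega> = h \<omega>'"
  shows "h \<in> borel_measurable M"
proof -
  define S where "S \<omega> = map (\<lambda>i. X (Suc i) \<omega>) [0..<n]" for \<omega>
  have "S \<in> measurable M (count_space UNIV)"
    unfolding measurable_count_space_eq2_countable
  proof (intro conjI ballI)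
    fix xs :: "nat list"
    have "S \<omega> = xs \<longleftrightarrow> length xs = n \<and> (\<forall>i\<in>{..<n}. X (Suc i) \<omega> = xs ! i)" for \<omega>
      unfolding S_def list_eq_iff_nth_eq by auto
    then have "S -` {xs} \<inter> space M =
        {\<omega> \<in> space M. length xs = n \<and> (\<forall>i\<in>{..<n}. X (Suc i) \<omega> = xs ! i)}"
      by blast
    also have "\<dots> \<in> sets M"
    proof (intro sets.sets_Collect_conj sets.sets_Collect_const sets.sets_Collect_finite_All)
      fix i
      show "{\<omega> \<in> space M. X (Suc i) \<omega> = xs ! i} \<in> events"
        using measurable_sets[OF X_measurable[of "Suc i"], of "{xs ! i}"]
        by (simp add: vimage_def Int_def conj_commute)
    qed auto
    finally show "S -` {xs} \<inter> space M \<in> sets M" .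
  qed auto
  \<comment> \<open>\<open>h\<close> factors through \<open>S\<close> by evaluating it at an
    arbitrary outcome with the same sample.\<close>
  moreover have "(\<lambda>xs. h (SOME \<omega>. S \<omega> = xs)) \<in> borel_measurable (count_space UNIV)"
    by simp
  ultimately have "(\<lambda>\<omega>. h (SOME \<omega>'. S \<omega>' = S \<omega>)) \<in> borel_measurable M"
    by (rule measurable_compose)
  moreover have "h (SOME \<omega>'. S \<omega>' = S \<omega>) = h \<omega>" for \<omega>
  proof -
    define \<omega>' where "\<omega>' = (SOME \<omega>'. S \<omega>' = S \<omega>)"
    have "S \<omega>' = S \<omega>"
      unfolding \<omega>'_def by (rule someI) (rule refl)
    then have "X (Suc j) \<omega>' = X (Suc j) \<omega>" if "j < n" for j
      using that by (simp add: S_def)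
    then have "X i \<omega>' = X i \<omega>" if "i \<in> {1..n}" for i
      using that by (cases i) auto
    then show ?thesis
      unfolding \<omega>'_def[symmetric] by (rule h)
  qed
  ultimately show ?thesis by simp
qed

lemma expectation_X:
  fixes g :: "nat \<Rightarrow> real"
  assumes "i \<ge> 1"
  shows "expectation (\<lambda>\<omega>. g (X i \<omega>)) = measure_pmf.expectation p g"
  unfolding distr[OF assms, symmetric] using X_measurable[OF assms]
  by (subst integral_distr) auto

lemma distr_X_Suc:
  fixes g :: "nat \<Rightarrow> real"
  shows "distr M borel (\<lambda>\<omega>. g (X (Suc i) \<omega>)) = distr (measure_pmf p) borel g"
  unfolding distr[of "Suc i", simplified, symmetric] using X_measurable[of "Suc i"]
  by (simp add: distr_distr comp_def)

text \<open>Reindexes the sample from 0, as the central limit theorem expects: the disjoint blocks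
  \<open>{Suc i}\<close> are independent, and evaluation at \<open>Suc i\<close> recovers the
  observation.\<close>

lemma indep_vars_X_Suc:
  fixes g :: "nat \<Rightarrow> real"
  shows "indep_vars (\<lambda>_. borel) (\<lambda>i \<omega>. g (X (Suc i) \<omega>)) UNIV"
proof -
  have "indep_vars (\<lambda>i. Pi\<^sub>M {Suc i} (\<lambda>_. count_space UNIV)) (\<lambda>i \<omega>. restrict (\<lambda>j. X j \<omega>) {Suc i}) UNIV"
    by (rule indep_vars_restrict[OF indep]) (auto simp: disjoint_family_on_def)
  then have "indep_vars (\<lambda>_. borel) (\<lambda>i \<omega>. g (restrict (\<lambda>j. X j \<omega>) {Suc i} (Suc i))) UNIV"
    by (rule indep_vars_compose2)
       (auto intro: measurable_compose[OF measurable_component_singleton])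
  then show ?thesis by simp
qed

section \<open>Frequencies as averages of independent centred terms\<close>

lemma empirical_eq: "empirical X n \<omega> x = (\<Sum>i<n. of_bool (X (Suc i) \<omega> = x)) / real n"
proof -
  have "real (card {i \<in> {1..n}. X i \<omega> = x}) = (\<Sum>i\<in>{1..n}. of_bool (X i \<omega> = x))"
    by (simp add: sum_of_bool_eq Int_def)
  also have "\<dots> = (\<Sum>i<n. of_bool (X (Suc i) \<omega> = x))"
    by (rule sum.reindex_cong[of Suc]) (auto simp: image_Suc_lessThan)
  finally show ?thesis
    by (simp only: empirical_def)
qed

text \<open>Contribution of one observation to the deviation at \<open>x\<close>, as a function of
  the observed value \<open>y\<close>, so that its moments are integrals under
  \<open>p\<close>.\<close>

definition centred :: "nat \<Rightarrow> nat \<Rightarrow> real" where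
  "centred x y = of_bool (y = x) - pmf p x"

lemma empirical_diff:
  assumes "n > 0"
  shows "empirical X n \<omega> x - pmf p x = (\<Sum>i<n. centred x (X (Suc i) \<omega>)) / real n"
  using assms unfolding empirical_eq centred_def sum_subtractf
  by (simp add: diff_divide_distrib del: sum_of_bool_eq)

lemma sqrt_empirical_diff:
  "sqrt (real n) * (empirical X n \<omega> x - pmf p x) = (\<Sum>i<n. centred x (X (Suc i) \<omega>)) / sqrt (real n)"
  \<comment> \<open>For \<open>n = 0\<close> both sides are 0: the square root on the left and the
    empty sum on the right vanish.\<close>
  by (cases "n = 0") (simp_all add: empirical_diff real_div_sqrt field_simps)

lemma centred_integrable: "integrable (measure_pmf p) (centred x)"
  "integrable (measure_pmf p) (\<lambda>y. centred x y * centred x' y)"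
proof -
  have "\<bar>centred x y\<bar> \<le> 1" for x y
    using pmf_nonneg[of p x] pmf_le_1[of p x] by (auto simp: centred_def)
  moreover from this have "\<bar>centred x y * centred x' y\<bar> \<le> 1" for y
    unfolding abs_mult by (intro mult_le_one) auto
  ultimately show "integrable (measure_pmf p) (centred x)"
      "integrable (measure_pmf p) (\<lambda>y. centred x y * centred x' y)"
    by (auto intro!: measure_pmf.integrable_const_bound[of _ 1])
qed

lemma expectation_of_bool: "measure_pmf.expectation p (\<lambda>y. of_bool (y = x)) = pmf p x"
proof -
  have "(\<lambda>y. of_bool (y = x) :: real) = indicator {x}"
    by (auto simp: indicator_def)
  then show ?thesis
    by (simp add: pmf.rep_eq)
qed

lemma expectation_centred: "measure_pmf.expectation p (centred x) = 0"
proof -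
  have "integrable (measure_pmf p) (\<lambda>y. of_bool (y = x) :: real)"
    by (rule measure_pmf.integrable_const_bound[of _ 1]) auto
  then show ?thesis
    unfolding centred_def by (simp add: expectation_of_bool)
qed

text \<open>Exactly the covariance prescribed in \<open>limit_process\<close>; this is where the
  limiting variances come to agree.\<close>

lemma expectation_centred_mult:
  "measure_pmf.expectation p (\<lambda>y. centred x y * centred x' y)
     = (if x = x' then pmf p x else 0) - pmf p x * pmf p x'"
proof -
  have int: "integrable (measure_pmf p) (\<lambda>y. of_bool (P y) :: real)" for P
    by (rule measure_pmf.integrable_const_bound[of _ 1]) auto
  have "centred x y * centred x' y = of_bool (x = x') * of_bool (y = x)
      - pmf p x' * of_bool (y = x) - pmf p x * of_bool (y = x') + pmf p x * pmf p x'" for y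
    by (auto simp: centred_def algebra_simps)
  then show ?thesis
    by (simp add: int expectation_of_bool)
qed

lemma expectation_empirical_diff_square:
  assumes "n > 0"
  shows "integrable M (\<lambda>\<omega>. (empirical X n \<omega> x - pmf p x)\<^sup>2)"
    and "expectation (\<lambda>\<omega>. (empirical X n \<omega> x - pmf p x)\<^sup>2) \<le> pmf p x / real n"
proof -
  have "integrable M (\<lambda>\<omega>. (centred x (X (Suc i) \<omega>))\<^sup>2)" for i
    using integrable_distr[OF X_measurable[of "Suc i"], of "\<lambda>y. (centred x y)\<^sup>2"]
      centred_integrable(2)[of x x] by (simp add: distr power2_eq_square)
  from indep_vars_sum_square[OF indep_vars_X_Suc _ this]
  have sum: "integrable M (\<lambda>\<omega>. (\<Sum>i<n. centred x (X (Suc i) \<omega>))\<^sup>2)"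
    "expectation (\<lambda>\<omega>. (\<Sum>i<n. centred x (X (Suc i) \<omega>))\<^sup>2) = real n * (pmf p x - pmf p x * pmf p x)"
    using expectation_X[of "Suc i" "\<lambda>y. centred x y * centred x y" for i] expectation_X[of "Suc i" "centred x" for i]
    by (auto simp: expectation_centred expectation_centred_mult power2_eq_square)
  have eq: "(empirical X n \<omega> x - pmf p x)\<^sup>2 = (\<Sum>i<n. centred x (X (Suc i) \<omega>))\<^sup>2 / (real n)\<^sup>2" for \<omega>
    unfolding empirical_diff[OF assms] by (rule power_divide)
  show "integrable M (\<lambda>\<omega>. (empirical X n \<omega> x - pmf p x)\<^sup>2)"
    unfolding eq using sum by simp
  have "expectation (\<lambda>\<omega>. (empirical X n \<omega> x - pmf p x)\<^sup>2) = (pmf p x - pmf p x * pmf p x) / real n"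
    unfolding eq using sum assms by (simp add: power2_eq_square)
  also have "\<dots> \<le> pmf p x / real n"
    by (intro divide_right_mono) auto
  finally show "expectation (\<lambda>\<omega>. (empirical X n \<omega> x - pmf p x)\<^sup>2) \<le> pmf p x / real n" .
qed

section \<open>Uniform closeness of the frequencies to \<open>p\<close>\<close>

lemma empirical_measurable: "(\<lambda>\<omega>. empirical X n \<omega> x) \<in> borel_measurable M"
  by (rule measurable_if_sample_determined[of n])
     (auto simp: empirical_def intro!: arg_cong[where f = card])

text \<open>Chebyshev's inequality for each \<open>x\<close>, and a union bound over all \<open>x\<close>: the variances are
  summable because \<open>p\<close> is.\<close>

lemma prob_uniform_deviation_le:
  assumes "n > 0" and "\<delta> > 0"
  shows "prob {\<omega> \<in> space M. \<exists>x. \<delta> \<le> \<bar>empirical X n \<omega> x - pmf p x\<bar>} \<le> 1 / (real n * \<delta>\<^sup>2)"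
proof -
  define A where "A x = {\<omega> \<in> space M. \<delta> \<le> \<bar>empirical X n \<omega> x - pmf p x\<bar>}" for x
  note [measurable] = empirical_measurable
  have A: "A x \<in> events" for x
    unfolding A_def by measurable
  have "prob (A x) \<le> expectation (\<lambda>\<omega>. (empirical X n \<omega> x - pmf p x)\<^sup>2) / \<delta>\<^sup>2" for x
    unfolding A_def using assms
    by (intro second_moment_method expectation_empirical_diff_square) auto
  also have "expectation (\<lambda>\<omega>. (empirical X n \<omega> x - pmf p x)\<^sup>2) / \<delta>\<^sup>2 \<le> pmf p x / (real n * \<delta>\<^sup>2)" for x
    using divide_right_mono[OF expectation_empirical_diff_square(2)[OF assms(1), of x], of "\<delta>\<^sup>2"] by simp
  finally have A_le: "prob (A x) \<le> pmf p x / (real n * \<delta>\<^sup>2)" for x .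
  have "(\<lambda>x. measure_pmf.prob p {x}) sums measure_pmf.prob p (\<Union>x. {x})"
    by (rule measure_pmf.finite_measure_UNION) (auto simp: disjoint_family_on_def)
  then have "pmf p sums 1"
    by (simp add: pmf.rep_eq measure_pmf.prob_space[simplified])
  then have total: "(\<lambda>x. pmf p x / (real n * \<delta>\<^sup>2)) sums (1 / (real n * \<delta>\<^sup>2))"
    by (rule sums_divide)
  have A_summable: "summable (\<lambda>x. prob (A x))"
    by (rule summable_comparison_test'[OF sums_summable[OF total]]) (use A_le in auto)
  have "{\<omega> \<in> space M. \<exists>x. \<delta> \<le> \<bar>empirical X n \<omega> x - pmf p x\<bar>} = (\<Union>x. A x)"
    by (auto simp: A_def)
  also have "prob \<dots> \<le> (\<Sum>x. prob (A x))"
    using A A_summable by (intro finite_measure_subadditive_countably) auto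
  also have "\<dots> \<le> (\<Sum>x. pmf p x / (real n * \<delta>\<^sup>2))"
    by (intro suminf_le A_le A_summable sums_summable[OF total])
  also have "\<dots> = 1 / (real n * \<delta>\<^sup>2)"
    using total by (rule sums_unique[symmetric])
  finally show ?thesis .
qed

end

section \<open>Central limit theorem and conclusion\<close>

lemma (in prob_space) gaussian_rv_square_integrable:
  assumes "gaussian_rv M Z"
  shows "integrable M (\<lambda>\<omega>. (Z \<omega>)\<^sup>2)"
proof -
  have Z [measurable]: "Z \<in> borel_measurable M"
    using assms by (simp add: gaussian_rv_def)
  consider \<mu> where "AE \<omega> in M. Z \<omega> = \<mu>"
    | \<mu> \<sigma> where "\<sigma> > 0" "distributed M lborel Z (\<lambda>x. ennreal (normal_density \<mu> \<sigma> x))"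
    using assms by (auto simp: gaussian_rv_def)
  then show ?thesis
  proof cases
    case (1 \<mu>)
    then show ?thesis
      by (subst integrable_cong_AE[where g = "\<lambda>_. \<mu>\<^sup>2"]) auto
  next
    case (2 \<mu> \<sigma>)
    \<comment> \<open>Expansion around the mean, reducing to the central second moment, the first
      moment and the total mass.\<close>
    have "normal_density \<mu> \<sigma> x * x\<^sup>2 = normal_density \<mu> \<sigma> x * (x - \<mu>) ^ 2
        + 2 * \<mu> * (normal_density \<mu> \<sigma> x * x) - \<mu>\<^sup>2 * normal_density \<mu> \<sigma> x" for x
      by (simp add: power2_eq_square algebra_simps)
    then have "integrable lborel (\<lambda>x. normal_density \<mu> \<sigma> x * x\<^sup>2)"
      using integrable_normal_moment[OF 2(1), of \<mu> 2] integrable_normal_moment_nz_1[OF 2(1), of \<mu>]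
        integrable_normal_density[OF 2(1), of \<mu>]
      by simp
    then show ?thesis
      using distributed_integrable[OF 2(2), of "\<lambda>x. x\<^sup>2"] by simp
  qed
qed

lemma limit_process_combination:
  fixes a :: "nat \<Rightarrow> real"
  assumes "limit_process p N Y" and I: "finite I"
  defines "U \<omega> \<equiv> \<Sum>x\<in>I. a x * Y \<omega> x"
  shows "gaussian_rv N U"
    and "(\<integral>\<omega>. U \<omega> \<partial>N) = 0"
    and "(\<integral>\<omega>. (U \<omega>)\<^sup>2 \<partial>N)
           = (\<Sum>x\<in>I. \<Sum>x'\<in>I. a x * a x' * ((if x = x' then pmf p x else 0) - pmf p x * pmf p x'))"
proof -
  interpret N: prob_space N
    using assms(1) by (simp add: limit_process_def)
  have mean: "(\<integral>\<omega>. Y \<omega> x \<partial>N) = 0" for x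
    using assms(1) by (simp add: limit_process_def)
  have cov: "(\<integral>\<omega>. Y \<omega> x * Y \<omega> x' \<partial>N) = (if x = x' then pmf p x else 0) - pmf p x * pmf p x'" for x x'
    using assms(1) by (simp add: limit_process_def covariance_def mean)
  have gaussian: "gaussian_rv N (\<lambda>\<omega>. \<Sum>x\<in>J. c x * Y \<omega> x)" if "finite J" for J c
    using assms(1) that by (simp add: limit_process_def gaussian_process_def)
  from gaussian[OF I, of a] show "gaussian_rv N U"
    by (simp add: U_def[abs_def])
  have Y: "gaussian_rv N (\<lambda>\<omega>. Y \<omega> x)" for x
    using gaussian[of "{x}" "\<lambda>_. 1"] by simp
  then have [measurable]: "(\<lambda>\<omega>. Y \<omega> x) \<in> borel_measurable N" for x
    by (simp add: gaussian_rv_def)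
  \<comment> \<open>The covariance equations do not yield integrability, since a non-integrable
    function has integral 0; it is drawn from Gaussianity of the single coordinates.\<close>
  note square = N.gaussian_rv_square_integrable[OF Y]
  have int: "integrable N (\<lambda>\<omega>. Y \<omega> x)" for x
    by (rule N.square_integrable_imp_integrable[OF _ square]) measurable
  have int2: "integrable N (\<lambda>\<omega>. Y \<omega> x * Y \<omega> x')" for x x'
  proof (rule Bochner_Integration.integrable_bound)
    show "integrable N (\<lambda>\<omega>. (Y \<omega> x)\<^sup>2 + (Y \<omega> x')\<^sup>2)"
      using square by simp
    have "\<bar>u * v\<bar> \<le> u\<^sup>2 + v\<^sup>2" for u v :: real
      using sum_squares_bound[of "\<bar>u\<bar>" "\<bar>v\<bar>"] abs_ge_zero[of "u * v"]
      unfolding abs_mult power2_abs by linarith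
    then show "AE \<omega> in N. norm (Y \<omega> x * Y \<omega> x') \<le> norm ((Y \<omega> x)\<^sup>2 + (Y \<omega> x')\<^sup>2)"
      by simp
  qed measurable
  show "(\<integral>\<omega>. U \<omega> \<partial>N) = 0"
    unfolding U_def by (simp add: int mean)
  have "(U \<omega>)\<^sup>2 = (\<Sum>x\<in>I. \<Sum>x'\<in>I. a x * a x' * (Y \<omega> x * Y \<omega> x'))" for \<omega>
    by (simp add: U_def power2_eq_square sum_product ac_simps)
  then show "(\<integral>\<omega>. (U \<omega>)\<^sup>2 \<partial>N)
      = (\<Sum>x\<in>I. \<Sum>x'\<in>I. a x * a x' * ((if x = x' then pmf p x else 0) - pmf p x * pmf p x'))"
    by (simp add: int2 cov)
qed

text \<open>Links the standard normal limit of the central limit theorem to \<open>U\<close>: the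
  variable \<open>U / \<sigma>\<close> is standard normal.\<close>

lemma expectation_std_normal_scale:
  assumes "prob_space N" and "\<sigma> > 0" and U: "distributed N lborel U (\<lambda>x. ennreal (normal_density 0 \<sigma> x))"
    and g [measurable]: "g \<in> borel_measurable borel"
  shows "(\<integral>t. g (\<sigma> * t) \<partial>std_normal_distribution) = (\<integral>\<omega>. g (U \<omega>) \<partial>N :: real)"
proof -
  interpret prob_space N by fact
  have g': "(\<lambda>t. g (\<sigma> * t)) \<in> borel_measurable lborel"
    by measurable
  have "distributed N lborel (\<lambda>\<omega>. U \<omega> / \<sigma>) (\<lambda>x. ennreal (std_normal_density x))"
    using U normal_standard_normal_convert[OF assms(2), of U 0] by simp
  from distributed_integral[OF this g']
  have "(\<integral>t. std_normal_density t * g (\<sigma> * t) \<partial>lborel) = (\<integral>\<omega>. g (U \<omega>) \<partial>N)"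
    using assms(2) by simp
  then show ?thesis
    using g' by (subst integral_density) auto
qed

section \<open>Convergence of linear combinations of frequencies\<close>

context iid_sample
begin

lemma empirical_combination_tendsto:
  fixes g :: "real \<Rightarrow> real"
  assumes Y: "limit_process p N Y" and I: "finite I"
    and g: "continuous_on UNIV g" and bdd: "bounded (range g)"
  shows "(\<lambda>n. expectation (\<lambda>\<omega>. g (\<Sum>x\<in>I. a x * (sqrt (real n) * (empirical X n \<omega> x - pmf p x)))))
           \<longlonglongrightarrow> (\<integral>\<omega>. g (\<Sum>x\<in>I. a x * Y \<omega> x) \<partial>N)"
proof -
  interpret N: prob_space N
    using Y by (simp add: limit_process_def)
  define U where "U \<omega> = (\<Sum>x\<in>I. a x * Y \<omega> x)" for \<omega>
  define v where "v = (\<integral>\<omega>. (U \<omega>)\<^sup>2 \<partial>N)"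
  note U = limit_process_combination[OF Y I, of a, folded U_def]
  define z where "z y = (\<Sum>x\<in>I. a x * centred x y)" for y
  define Z where "Z i \<omega> = z (X (Suc i) \<omega>)" for i \<omega>
  have z_mean: "measure_pmf.expectation p z = 0"
    unfolding z_def by (simp add: centred_integrable expectation_centred)
  have z_square: "(z y)\<^sup>2 = (\<Sum>x\<in>I. \<Sum>x'\<in>I. a x * a x' * (centred x y * centred x' y))" for y
    by (simp add: z_def power2_eq_square sum_product ac_simps)
  have z_var: "measure_pmf.expectation p (\<lambda>y. (z y)\<^sup>2) = v"
    unfolding z_square v_def U(3) by (simp add: centred_integrable expectation_centred_mult)
  have z_int: "integrable (measure_pmf p) (\<lambda>y. (z y)\<^sup>2)"
    unfolding z_square by (simp add: centred_integrable)
  have indep_Z: "indep_vars (\<lambda>_. borel) Z UNIV"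
    using indep_vars_X_Suc[of z] by (simp add: Z_def[abs_def])
  have Z_meas [measurable]: "Z i \<in> borel_measurable M" for i
    using indep_Z by (simp add: indep_vars_def2)
  have Z_mean: "expectation (Z i) = 0" for i
    using expectation_X[of "Suc i" z] z_mean by (simp add: Z_def[abs_def])
  have Z_var: "expectation (\<lambda>\<omega>. (Z i \<omega>)\<^sup>2) = v" for i
    using expectation_X[of "Suc i" "\<lambda>y. (z y)\<^sup>2"] z_var by (simp add: Z_def)
  have Z_int: "integrable M (\<lambda>\<omega>. (Z i \<omega>)\<^sup>2)" for i
    using integrable_distr[OF X_measurable[of "Suc i"], of "\<lambda>y. (z y)\<^sup>2"] z_int
    by (simp add: distr Z_def)
  \<comment> \<open>Exchanging the sums over \<open>x\<close> and \<open>i\<close> turns the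
    combination into a normalised sum of i.i.d. variables whose variance \<open>v\<close> is that of
    \<open>U\<close>.\<close>
  have sum_eq: "(\<Sum>x\<in>I. a x * (sqrt (real n) * (empirical X n \<omega> x - pmf p x)))
      = (\<Sum>i<n. Z i \<omega>) / sqrt (real n)" for n \<omega>
    unfolding sqrt_empirical_diff Z_def z_def
    by (subst sum.swap) (simp add: sum_distrib_left sum_divide_distrib)
  have g_meas [measurable]: "g \<in> borel_measurable borel"
    by (rule borel_measurable_continuous_onI[OF g])
  obtain B where B: "\<And>t. \<bar>g t\<bar> \<le> B"
    using bdd by (auto simp: bounded_iff)
  have [measurable]: "U \<in> borel_measurable N"
    using U(1) by (simp add: gaussian_rv_def)
  consider \<mu> where "AE \<omega> in N. U \<omega> = \<mu>"
    | \<mu> \<sigma> where "\<sigma> > 0" "distributed N lborel U (\<lambda>x. ennreal (normal_density \<mu> \<sigma> x))"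
    using U(1) by (auto simp: gaussian_rv_def)
  then have "(\<lambda>n. expectation (\<lambda>\<omega>. g ((\<Sum>i<n. Z i \<omega>) / sqrt (real n)))) \<longlonglongrightarrow> (\<integral>\<omega>. g (U \<omega>) \<partial>N)"
  proof cases
    case (1 \<mu>)
    \<comment> \<open>Degenerate limit: the mean forces \<open>U = 0\<close> almost surely, so
      \<open>v = 0\<close>. The partial sums then have second moment \<open>n * v = 0\<close>, and
      both sides equal \<open>g 0\<close>.\<close>
    have "(\<integral>\<omega>. U \<omega> \<partial>N) = (\<integral>\<omega>. \<mu> \<partial>N)"
      using 1 by (intro integral_cong_AE) auto
    then have "\<mu> = 0"
      using U(2) by (simp add: N.prob_space)
    with 1 have U0: "AE \<omega> in N. U \<omega> = 0" by simp
    then have "v = (\<integral>\<omega>. 0 \<partial>N)"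
      unfolding v_def by (intro integral_cong_AE) auto
    then have "v = 0" by simp
    then have sum_0: "AE \<omega> in M. (\<Sum>i<n. Z i \<omega>)\<^sup>2 = 0" for n
      using indep_vars_sum_square[OF indep_Z Z_mean Z_int Z_var, of n]
      by (subst integral_nonneg_eq_0_iff_AE[symmetric]) auto
    have "AE \<omega> in M. g ((\<Sum>i<n. Z i \<omega>) / sqrt (real n)) = g 0" for n
      using sum_0[of n] by eventually_elim simp
    then have "expectation (\<lambda>\<omega>. g ((\<Sum>i<n. Z i \<omega>) / sqrt (real n))) = expectation (\<lambda>_. g 0)" for n
      by (intro integral_cong_AE) measurable
    moreover have "(\<integral>\<omega>. g (U \<omega>) \<partial>N) = (\<integral>\<omega>. g 0 \<partial>N)"
      using U0 by (intro integral_cong_AE) auto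
    ultimately show ?thesis by (simp add: prob_space N.prob_space)
  next
    case (2 \<mu> \<sigma>)
    have "\<mu> = 0"
      using N.normal_distributed_expectation[OF 2] U(2) by simp
    with 2 have dist: "distributed N lborel U (\<lambda>x. ennreal (normal_density 0 \<sigma> x))" by simp
    have v: "v = \<sigma>\<^sup>2"
      using N.normal_distributed_variance[OF 2] U(2) by (simp add: v_def)
    have Z_variance: "variance (Z i) = \<sigma>\<^sup>2" for i
      using Z_var v by (simp add: Z_mean)
    have Z_distr: "distr M borel (Z i) = distr (measure_pmf p) borel z" for i
      unfolding Z_def[abs_def] by (rule distr_X_Suc)
    from central_limit_theorem_zero_mean[OF indep_Z Z_mean 2(1) Z_int Z_variance Z_distr]
    have clt: "weak_conv_m (\<lambda>n. distr M borel (\<lambda>\<omega>. (\<Sum>i<n. Z i \<omega>) / sqrt (real n * \<sigma>\<^sup>2)))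
        std_normal_distribution" .
    \<comment> \<open>The theorem normalises to unit variance; testing with
      \<open>g (\<sigma> * t)\<close> undoes this.\<close>
    have "(\<lambda>n. \<integral>t. g (\<sigma> * t) \<partial>distr M borel (\<lambda>\<omega>. (\<Sum>i<n. Z i \<omega>) / sqrt (real n * \<sigma>\<^sup>2)))
        \<longlonglongrightarrow> (\<integral>t. g (\<sigma> * t) \<partial>std_normal_distribution)"
    proof (rule weak_conv_imp_integral_bdd_continuous_conv[OF _ _ clt, where B = B])
      show "real_distribution (distr M borel (\<lambda>\<omega>. (\<Sum>i<n. Z i \<omega>) / sqrt (real n * \<sigma>\<^sup>2)))" for n
        by (rule real_distribution_distr) measurable
      have isCont_g: "isCont g t" for t
        using g by (simp add: continuous_on_eq_continuous_at)
      show "isCont (\<lambda>t. g (\<sigma> * t)) t" for t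
        by (rule isCont_o2[OF _ isCont_g]) (intro continuous_intros)
    qed (simp_all add: B real_dist_normal_dist)
    moreover have "(\<integral>t. g (\<sigma> * t) \<partial>distr M borel (\<lambda>\<omega>. (\<Sum>i<n. Z i \<omega>) / sqrt (real n * \<sigma>\<^sup>2)))
        = expectation (\<lambda>\<omega>. g ((\<Sum>i<n. Z i \<omega>) / sqrt (real n)))" for n
      using 2(1) by (subst integral_distr) (auto simp: real_sqrt_mult)
    ultimately show ?thesis
      by (simp add: expectation_std_normal_scale[OF N.prob_space_axioms 2(1) dist g_meas])
  qed
  then show ?thesis
    by (simp only: sum_eq U_def)
qed

section \<open>Agreement of the estimators with the empirical frequencies\<close>

lemma empirical_determined:
  assumes "\<And>i. i \<in> {1..n} \<Longrightarrow> X i \<omega> = X i \<omega>'"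
  shows "empirical X n \<omega> = empirical X n \<omega>'" "empirical_vec X n \<omega> = empirical_vec X n \<omega>'"
proof -
  show *: "empirical X n \<omega> = empirical X n \<omega>'"
    using assms by (auto simp: empirical_def fun_eq_iff intro!: arg_cong[where f = card])
  have "(\<lambda>i. X i \<omega>) ` {1..n} = (\<lambda>i. X i \<omega>') ` {1..n}"
    using assms by (intro image_cong) auto
  then show "empirical_vec X n \<omega> = empirical_vec X n \<omega>'"
    unfolding empirical_vec_def * by simp
qed

lemma estimator_eq_empirical:
  assumes before: "\<And>i. i < x \<Longrightarrow> empirical X n \<omega> x \<le> empirical X n \<omega> i"
    and after: "\<And>i. x < i \<Longrightarrow> empirical X n \<omega> i \<le> empirical X n \<omega> x"
  shows "rear_estimator X n \<omega> x = empirical X n \<omega> x" "gren_estimator X n \<omega> x = empirical X n \<omega> x"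
proof -
  define m where "m = Suc (Max ((\<lambda>i. X i \<omega>) ` {1..n}))"
  have vec: "empirical_vec X n \<omega> = map (empirical X n \<omega>) [0..<m]"
    unfolding empirical_vec_def m_def ..
  have "rear_estimator X n \<omega> x = empirical X n \<omega> x \<and> gren_estimator X n \<omega> x = empirical X n \<omega> x"
  proof (cases "x < m")
    case True
    have "rear (empirical_vec X n \<omega>) ! x = empirical X n \<omega> x" "gren (empirical_vec X n \<omega>) ! x = empirical X n \<omega> x"
      using rear_nth_eq[of x "empirical_vec X n \<omega>"] gren_nth_eq[of x "empirical_vec X n \<omega>"]
        before after True by (simp_all add: vec)
    then show ?thesis
      using True by (simp add: rear_estimator_def gren_estimator_def nth_default_def vec)
  next
    case False
    \<comment> \<open>Beyond the largest observation the frequency is 0, which is also the default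
      value that extends both estimators.\<close>
    have "X i \<omega> \<noteq> x" if "i \<in> {1..n}" for i
    proof -
      have "X i \<omega> \<le> Max ((\<lambda>i. X i \<omega>) ` {1..n})"
        using that by (intro Max_ge) auto
      then show ?thesis
        using False unfolding m_def by linarith
    qed
    then have "{i \<in> {1..n}. X i \<omega> = x} = {}" by blast
    then have "empirical X n \<omega> x = 0"
      by (simp add: empirical_def)
    then show ?thesis
      using False by (simp add: rear_estimator_def gren_estimator_def nth_default_def vec)
  qed
  then show "rear_estimator X n \<omega> x = empirical X n \<omega> x" "gren_estimator X n \<omega> x = empirical X n \<omega> x"
    by blast+
qed

end

theorem proposition3p6:
  fixes M :: "'a measure" and N :: "'b measure"
    and X :: "nat \<Rightarrow> 'a \<Rightarrow> nat" and p :: "nat pmf"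
    and Y :: "'b \<Rightarrow> nat \<Rightarrow> real" and r s :: nat
  assumes "prob_space M"
    and "prob_space.indep_vars M (\<lambda>_. count_space UNIV) X {1..}"
    and "\<And>i. i \<ge> 1 \<Longrightarrow> distr M (count_space UNIV) (X i) = measure_pmf p"
    and "\<And>x. pmf p x \<ge> pmf p (x + 1)"
    and "limit_process p N Y"
    and "r \<le> s"
    and "r > 0 \<Longrightarrow> pmf p (r - 1) > pmf p r"
    and "\<And>x. r \<le> x \<Longrightarrow> x \<le> s \<Longrightarrow> pmf p x > pmf p (x + 1)"
  shows "converges_in_distribution {r..s}
           M (\<lambda>n \<omega>. restrict (Y_R p X n \<omega>) {r..s}) N (\<lambda>\<omega>. restrict (Y \<omega>) {r..s})
       \<and> converges_in_distribution {r..s}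
           M (\<lambda>n \<omega>. restrict (Y_G p X n \<omega>) {r..s}) N (\<lambda>\<omega>. restrict (Y \<omega>) {r..s})"
proof -
  interpret prob_space M by fact
  interpret iid_sample M X p
    by unfold_locales (fact assms(2,3))+
  have mono: "pmf p y \<le> pmf p x" if "x \<le> y" for x y
    by (rule lift_Suc_antimono_le[OF _ that]) (use assms(4) in simp)
  \<comment> \<open>\<open>D\<close> collects the drops of \<open>p\<close> after each point of
    \<open>{r..s}\<close> and, if there is a predecessor, the drop into \<open>r\<close>. With
    \<open>\<delta>\<close> half the smallest one, two deviations below \<open>\<delta>\<close>
    cannot reverse the order across a drop.\<close>
  define D where "D = (\<lambda>x. pmf p x - pmf p (x + 1)) ` {r..s} \<union> (if r > 0 then {pmf p (r - 1) - pmf p r} else {})"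
  define \<delta> where "\<delta> = Min D / 2"
  have D: "finite D" "D \<noteq> {}" "\<And>d. d \<in> D \<Longrightarrow> 0 < d"
    using assms(6-8) by (auto simp: D_def split: if_splits)
  then have "\<delta> > 0"
    by (simp add: \<delta>_def)
  have D_ge: "2 * \<delta> \<le> d" if "d \<in> D" for d
    using D(1) that by (simp add: \<delta>_def)
  have gap_after: "pmf p i \<le> pmf p x - 2 * \<delta>" if "x \<in> {r..s}" "x < i" for x i
    using D_ge[of "pmf p x - pmf p (x + 1)"] mono[of "x + 1" i] that by (auto simp: D_def)
  \<comment> \<open>At \<open>x = r\<close> the extra drop is used, and \<open>i < r\<close>
    guarantees that it belongs to \<open>D\<close>; at larger \<open>x\<close> the drop after
    \<open>x - 1\<close> serves.\<close>
  have gap_before: "pmf p x + 2 * \<delta> \<le> pmf p i" if "x \<in> {r..s}" "i < x" for x i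
  proof (cases "x = r")
    case True
    then have "pmf p (r - 1) - pmf p r \<in> D" "i \<le> r - 1"
      using that by (auto simp: D_def)
    from D_ge[OF this(1)] mono[OF this(2)] True show ?thesis
      by simp
  next
    case False
    then have "x - 1 \<in> {r..s}" "x - 1 < x" "i \<le> x - 1"
      using that by auto
    from gap_after[OF this(1,2)] mono[OF this(3)] show ?thesis
      by linarith
  qed
  define B where "B n = {\<omega> \<in> space M. \<exists>x. \<delta> \<le> \<bar>empirical X n \<omega> x - pmf p x\<bar>}" for n
  note [measurable] = empirical_measurable
  have B: "B n \<in> events" for n
    unfolding B_def by measurable
  have "(\<lambda>n. prob (B n)) \<longlonglongrightarrow> 0"
  proof (rule tendsto_sandwich[OF _ _ tendsto_const])
    show "\<forall>\<^sub>F n in sequentially. prob (B n) \<le> 1 / (real n * \<delta>\<^sup>2)"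
      unfolding B_def using prob_uniform_deviation_le[OF _ \<open>\<delta> > 0\<close>]
      by (intro eventually_mono[OF eventually_gt_at_top[of 0]]) auto
    show "(\<lambda>n. 1 / (real n * \<delta>\<^sup>2)) \<longlonglongrightarrow> 0"
      using lim_const_over_n[of "1 / \<delta>\<^sup>2"] by (simp add: mult.commute)
  qed auto
  note B = B this
  have estimators: "rear_estimator X n \<omega> x = empirical X n \<omega> x \<and> gren_estimator X n \<omega> x = empirical X n \<omega> x"
    if "\<omega> \<in> space M" "\<omega> \<notin> B n" "x \<in> {r..s}" for n \<omega> x
  proof -
    \<comment> \<open>Closeness is required at every index, not just in \<open>{r..s}\<close>,
      because the order conditions compare \<open>x\<close> with all other positions.\<close>
    have near: "\<bar>empirical X n \<omega> i - pmf p i\<bar> < \<delta>" for i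
      using that by (auto simp: B_def not_le)
    have "empirical X n \<omega> x \<le> empirical X n \<omega> i" if "i < x" for i
      using near[of x] near[of i] gap_before[OF \<open>x \<in> {r..s}\<close> that] by linarith
    moreover have "empirical X n \<omega> i \<le> empirical X n \<omega> x" if "x < i" for i
      using near[of x] near[of i] gap_after[OF \<open>x \<in> {r..s}\<close> that] by linarith
    ultimately show ?thesis
      using estimator_eq_empirical[of x n \<omega>] by blast
  qed
  have Y: "(\<lambda>\<omega>. Y \<omega> x) \<in> borel_measurable N" for x
    using limit_process_combination(1)[OF assms(5), of "{x}" "\<lambda>_. 1"] by (simp add: gaussian_rv_def)
  have "prob_space N"
    using assms(5) by (simp add: limit_process_def)
  have empirical: "converges_in_distribution {r..s}
      M (\<lambda>n \<omega>. \<lambda>x\<in>{r..s}. sqrt (real n) * (empirical X n \<omega> x - pmf p x)) N (\<lambda>\<omega>. restrict (Y \<omega>) {r..s})"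
  proof (rule converges_in_distribution_Cramer_Wold[OF prob_space_axioms \<open>prob_space N\<close>])
    fix a and g :: "real \<Rightarrow> real"
    assume "continuous_on UNIV g" "bounded (range g)"
    from empirical_combination_tendsto[OF assms(5) finite_atLeastAtMost this]
    show "(\<lambda>n. expectation (\<lambda>\<omega>. g (\<Sum>i\<in>{r..s}. a i *
          restrict (\<lambda>x. sqrt (real n) * (empirical X n \<omega> x - pmf p x)) {r..s} i)))
        \<longlonglongrightarrow> (\<integral>\<omega>. g (\<Sum>i\<in>{r..s}. a i * restrict (Y \<omega>) {r..s} i) \<partial>N)"
      by simp
  qed (auto intro!: measurable_restrict Y)
  \<comment> \<open>Both estimators at a fixed \<open>x\<close> are functions of the empirical
    vector, hence determined by the sample.\<close>
  have vec: "(\<lambda>\<omega>. h (empirical_vec X n \<omega>)) \<in> borel_measurable M" for h :: "real list \<Rightarrow> real" and n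
    by (rule measurable_if_sample_determined[of n]) (metis empirical_determined(2))
  show ?thesis
  proof
    show "converges_in_distribution {r..s}
        M (\<lambda>n \<omega>. restrict (Y_R p X n \<omega>) {r..s}) N (\<lambda>\<omega>. restrict (Y \<omega>) {r..s})"
      by (rule converges_in_distribution_modify[OF empirical _ B])
         (auto intro!: measurable_restrict vec simp: Y_R_def rear_estimator_def[abs_def] estimators[unfolded rear_estimator_def])
    show "converges_in_distribution {r..s}
        M (\<lambda>n \<omega>. restrict (Y_G p X n \<omega>) {r..s}) N (\<lambda>\<omega>. restrict (Y \<omega>) {r..s})"
      by (rule converges_in_distribution_modify[OF empirical _ B])
         (auto intro!: measurable_restrict vec simp: Y_G_def gren_estimator_def[abs_def] estimators[unfolded gren_estimator_def])
  qed
qed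

end
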